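(* Suppose that $T$ is an open quipu on $n$ vertices ($n\geq 6$) with $\rho(T)<\frac{3}{2}\sqrt{2}$. Then the diameter of $T$ satisfies $D(T)\geq \frac{2n-4}{3}$. The equality holds if and only if $T=P_{(1,m-2,m)}^{(1,m)}$ for some $m\geq 2$.
   Context: All graphs are finite, simple and connected. $\rho(G)$ denotes the spectral radius of $G$, i.e. the largest eigenvalue of its adjacency matrix. $D(G)$ denotes the diameter of $G$, the maximum distance between a pair of vertices. An internal path of a graph is a path whose internal vertices have degree 2 and whose two end vertices have degree at least 3; its length is its number of edges, so an internal path with $k$ internal vertices has length $k+1$. A pendent path is a path from a vertex of degree at least 3 ending at a leaf, all of whose other vertices have degree 2; its length is its number of edges. An open quipu is a tree with maximum degree at most 3 whose vertices of degree 3 all lie on a single path. Concretely, $P_{(k_0,k_1,\dots,k_r,k_{r+1})}^{(m_0,m_1,\dots,m_r)}$ denotes the open quipu consisting of a path $v_0,\dots,v_r$ of $r+1$ degree-3 vertices, where consecutive $v_{i-1},v_i$ are joined by an internal path with $k_i$ internal vertices (length $k_i+1$) for $1\le i\le r$; a pendent path of length $m_i$ is attached at $v_i$ for each $0\le i\le r$; and additionally pendent paths of lengths $k_0$ at $v_0$ and $k_{r+1}$ at $v_r$ (here $m_i\ge 1$, $k_j\ge 0$ for $1\le j\le r$, and w.l.o.g. $m_0\le k_0$, $m_r\le k_{r+1}$). A T-shape tree (a tree with exactly one vertex of degree 3, with three pendent paths) is also regarded as an open quipu (case $r=0$). In particular, $P_{(1,m-2,m)}^{(1,m)}$ is the tree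 with two degree-3 vertices $u,v$ joined by a path of length $m-1$, where $u$ has two pendent paths of length 1 and $v$ has two pendent paths of length $m$. *)

theory Defs
  imports
    "Graph_Theory.Graph_Theory"
    "Jordan_Normal_Form.Spectral_Radius"
begin

text \<open>
  A finite simple graph is a \<^term>\<open>G :: 'a pair_pre_digraph\<close> with \<^prop>\<open>pair_graph G\<close>: every
  undirected edge \<open>uv\<close> is represented by the two arcs \<open>(u,v)\<close> and \<open>(v,u)\<close>.
\<close>

definition vertex_enum :: "'a pair_pre_digraph \<Rightarrow> nat \<Rightarrow> 'a" where
  "vertex_enum G = (SOME f. bij_betw f {..<card (pverts G)} (pverts G))"

text \<open>Different vertex enumerations give similar matrices, so the spectrum does not depend on
  the choice made in \<^const>\<open>vertex_enum\<close>.\<close>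

definition adjacency_matrix :: "'a pair_pre_digraph \<Rightarrow> real mat" where
  "adjacency_matrix G = mat (card (pverts G)) (card (pverts G))
     (\<lambda>(i, j). if (vertex_enum G i, vertex_enum G j) \<in> parcs G then 1 else 0)"

text \<open>The adjacency matrix is symmetric, so the real spectrum is the whole spectrum.\<close>

definition graph_spectral_radius :: "'a pair_pre_digraph \<Rightarrow> real" where
  "graph_spectral_radius G = Max (spectrum (adjacency_matrix G))"

definition graph_dist :: "'a pair_pre_digraph \<Rightarrow> 'a \<Rightarrow> 'a \<Rightarrow> nat" where
  "graph_dist G u v = (LEAST k. \<exists>p. pre_digraph.awalk (with_proj G) u p v \<and> length p = k)"

definition graph_diameter :: "'a pair_pre_digraph \<Rightarrow> nat" where
  "graph_diameter G = Max {graph_dist G u v | u v. u \<in> pverts G \<and> v \<in> pverts G}"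

text \<open>In a symmetric digraph every vertex has as many incoming as outgoing arcs, namely one of
  each per incident undirected edge.\<close>

definition graph_degree :: "'a pair_pre_digraph \<Rightarrow> 'a \<Rightarrow> nat" where
  "graph_degree G v = out_degree (with_proj G) v"

text \<open>
  The library's \<^const>\<open>Digraph_Component.tree\<close> is not usable for undirected graphs: in a symmetric
  digraph each edge yields a directed cycle \<open>u, v, u\<close> of length 2. The cycles of length
  at least 3 are exactly the cycles of the underlying simple graph.
\<close>

definition undirected_tree :: "'a pair_pre_digraph \<Rightarrow> bool" where
  "undirected_tree G \<longleftrightarrow>
     Digraph_Component.connected (with_proj G) \<and>
     \<not> (\<exists>p. pre_digraph.cycle (with_proj G) p \<and> 3 \<le> length p)"

definition open_quipu :: "'a pair_pre_digraph \<Rightarrow> bool" where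
  "open_quipu G \<longleftrightarrow>
     undirected_tree G \<and>
     (\<forall>v \<in> pverts G. graph_degree G v \<le> 3) \<and>
     (\<exists>u p w. pre_digraph.apath (with_proj G) u p w \<and>
        {v \<in> pverts G. graph_degree G v = 3} \<subseteq> set (pre_digraph.awalk_verts (with_proj G) u p))"

text \<open>
  The open quipu with parameters \<open>ks = [k\<^sub>0, \<dots>, k\<^sub>r\<^sub>+\<^sub>1]\<close> and \<open>ms = [m\<^sub>0, \<dots>, m\<^sub>r]\<close>, drawn in the grid.
  The pendent path of length \<open>k\<^sub>0\<close>, the internal paths and the pendent path of length \<open>k\<^sub>r\<^sub>+\<^sub>1\<close>
  together form the horizontal path \<open>(0,0), \<dots>, (L,0)\<close> with
  \<open>L = k\<^sub>0 + (k\<^sub>1 + 1) + \<dots> + (k\<^sub>r + 1) + k\<^sub>r\<^sub>+\<^sub>1\<close>; the vertex \<open>v\<^sub>i\<close> of degree 3 is \<open>(x\<^sub>i,0)\<close> with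
  \<open>x\<^sub>i = k\<^sub>0 + (k\<^sub>1 + 1) + \<dots> + (k\<^sub>i + 1)\<close>, and the pendent path of length \<open>m\<^sub>i\<close> at \<open>v\<^sub>i\<close> is
  \<open>(x\<^sub>i,0), \<dots>, (x\<^sub>i,m\<^sub>i)\<close>.
\<close>

definition quipu_pos :: "nat list \<Rightarrow> nat \<Rightarrow> nat" where
  "quipu_pos ks i = sum_list (take (Suc i) ks) + i"

definition quipu_verts :: "nat list \<Rightarrow> nat list \<Rightarrow> (nat \<times> nat) set" where
  "quipu_verts ks ms =
     {(x, 0) | x. x \<le> sum_list ks + (length ms - 1)} \<union>
     {(quipu_pos ks i, y) | i y. i < length ms \<and> y \<le> ms ! i}"

definition quipu_adj :: "nat \<times> nat \<Rightarrow> nat \<times> nat \<Rightarrow> bool" where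
  "quipu_adj a b \<longleftrightarrow>
     (snd a = 0 \<and> snd b = 0 \<and> (fst b = Suc (fst a) \<or> fst a = Suc (fst b))) \<or>
     (fst a = fst b \<and> (snd b = Suc (snd a) \<or> snd a = Suc (snd b)))"

definition quipu :: "nat list \<Rightarrow> nat list \<Rightarrow> (nat \<times> nat) pair_pre_digraph" where
  "quipu ks ms = \<lparr> pverts = quipu_verts ks ms,
     parcs = {(a, b). a \<in> quipu_verts ks ms \<and> b \<in> quipu_verts ks ms \<and> quipu_adj a b} \<rparr>"

end

theory Submission
  imports Defs "HOL-Analysis.Function_Topology"
begin

text \<open>
  Choose a longest path containing all vertices of degree 3; the quipu then becomes a comb with
  spine \<open>0, \<dots>, L\<close> and a hanging path of length \<open>h x\<close> at each \<open>x\<close>, where maximality bounds the first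
  and the last nonzero \<open>h x\<close> by the distance of \<open>x\<close> to the nearer end. Since \<open>n = L + 1 + \<Sum>h\<close> and
  the diameter is at least \<open>L\<close>, it suffices to show \<open>2 \<Sum>h \<le> L + 2\<close>.

  The spectral hypothesis says that \<open>3/\<surd>2 - A\<close> is positive definite. Because
  \<open>3/\<surd>2 = t + 1/t\<close> with \<open>t = \<surd>2\<close>, eliminating the hanging paths and then the spine from both ends
  gives a Moebius recursion whose solutions along bare paths are powers of 2. Positivity of the pivot
  at a branch vertex compares the power of 2 collected from the two sides with the one lost to
  the hanging paths. With three or more branch vertices the resulting inequality is strict; with two
  it reads \<open>(2\<^sup>p\<^sup>+\<^sup>1 - 3) (2\<^sup>q\<^sup>+\<^sup>1 - 3) < 2\<^sup>g\<^sup>+\<^sup>2\<close> for arms \<open>p\<close>, \<open>q\<close> at distance \<open>g\<close>, which leaves only the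
  stated extremal trees.
\<close>

section \<open>The quadratic form of the adjacency matrix\<close>

text \<open>A nonzero linear term would dominate for small \<open>t\<close> of the sign that makes
  it negative. This is the first-order condition at a maximiser.\<close>

lemma linear_coeff_zero:
  fixes b c :: real
  assumes "\<And>t. 0 \<le> 2 * t * b + t\<^sup>2 * c"
  shows "b = 0"
proof (rule ccontr)
  assume "b \<noteq> 0"
  define d where "d = \<bar>c\<bar> + 1"
  have d: "d > 0" "c < d" "c \<le> d" by (auto simp: d_def)
  have "2 * (- b / d) * b + (- b / d)\<^sup>2 * c \<le> 2 * (- b / d) * b + (- b / d)\<^sup>2 * d"
    using d by (intro add_left_mono mult_left_mono) auto
  also have "\<dots> = - b\<^sup>2 / d" using d by (simp add: power2_eq_square field_simps)
  also have "\<dots> < 0" using d \<open>b \<noteq> 0\<close> by simp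
  finally show False using assms[of "- b / d"] by simp
qed

text \<open>A maximiser of the Rayleigh quotient on the unit sphere exists by compactness, and
  vanishing of the first variation makes it an eigenvector; the maximum is the eigenvalue
  \<open>m\<close>.\<close>

lemma symmetric_form_max_eigenvector:
  fixes a :: "'a \<Rightarrow> 'a \<Rightarrow> real"
  assumes V: "finite V" "V \<noteq> {}" and sym: "\<And>x y. a x y = a y x"
  obtains m v where "\<exists>x\<in>V. v x \<noteq> 0" "\<And>x. x \<in> V \<Longrightarrow> (\<Sum>y\<in>V. a x y * v y) = m * v x"
    "\<And>u. (\<Sum>x\<in>V. \<Sum>y\<in>V. a x y * (u x * u y)) \<le> m * (\<Sum>x\<in>V. (u x)\<^sup>2)"
proof -
  define q where "q u = (\<Sum>x\<in>V. \<Sum>y\<in>V. a x y * (u x * u y))" for u :: "'a \<Rightarrow> real"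
  define N where "N u = (\<Sum>x\<in>V. (u x)\<^sup>2)" for u :: "'a \<Rightarrow> real"
  \<comment> \<open>Coordinates off \<open>V\<close> are pinned to \<open>0\<close>, so the unit
    sphere becomes a closed subset of a compact product.\<close>
  define S where "S x = (if x \<in> V then {-1..1} else {0::real})" for x
  define K where "K = PiE UNIV S \<inter> {u. N u = 1}"
  have "compactin (product_topology (\<lambda>_. euclidean) UNIV) (PiE UNIV S)"
    by (auto simp: compactin_PiE S_def)
  then have "compact (PiE UNIV S)"
    by (simp add: euclidean_product_topology)
  moreover have contN: "continuous_on UNIV N" unfolding N_def
    by (intro continuous_intros continuous_on_product_coordinates)
  then have "closed {u. N u = 1}"
    by (intro closed_Collect_eq continuous_on_const)
  ultimately have K: "compact K" unfolding K_def by (rule compact_Int_closed)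
  have contq: "continuous_on K q" unfolding q_def
    by (rule continuous_on_subset[of UNIV])
      (intro continuous_intros continuous_on_product_coordinates subset_UNIV)+
  obtain x0 where x0: "x0 \<in> V" using V by blast
  have "N (\<lambda>x. if x = x0 then 1 else 0) = 1"
    using x0 V by (simp add: N_def if_distrib[of "\<lambda>z. z\<^sup>2"] cong: if_cong)
  then have "(\<lambda>x. if x = x0 then 1 else 0) \<in> K"
    using x0 by (auto simp: K_def S_def PiE_iff)
  then have "K \<noteq> {}" by blast
  then obtain v where v: "v \<in> K" "\<And>u. u \<in> K \<Longrightarrow> q u \<le> q v"
    using continuous_attains_sup[OF K _ contq] by blast
  have Nv: "N v = 1" using v(1) by (simp add: K_def)
  have le: "q u \<le> q v * N u" for u
  proof (cases "N u = 0")
    case True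
    then have "\<forall>x\<in>V. u x = 0" unfolding N_def using V by (simp add: sum_nonneg_eq_0_iff)
    then show ?thesis using True by (simp add: q_def)
  next
    case False
    have "N u \<ge> 0" unfolding N_def by (simp add: sum_nonneg)
    then have pos: "N u > 0" using False by simp
    define r where "r = sqrt (N u)"
    have r: "r > 0" "r\<^sup>2 = N u" using pos by (auto simp: r_def)
    define w where "w x = (if x \<in> V then u x / r else 0)" for x
    have Nw: "N w = 1"
    proof -
      have "N w = (\<Sum>x\<in>V. (u x)\<^sup>2 / r\<^sup>2)" unfolding N_def w_def by (simp add: power_divide)
      also have "\<dots> = N u / r\<^sup>2" unfolding N_def by (simp add: sum_divide_distrib)
      finally show ?thesis using r pos by simp
    qed
    have "\<bar>w x\<bar> \<le> 1" if "x \<in> V" for x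
    proof -
      have "(w x)\<^sup>2 \<le> N w" unfolding N_def using V that by (intro member_le_sum) auto
      then show ?thesis using Nw by (simp add: abs_square_le_1)
    qed
    then have "- 1 \<le> w x \<and> w x \<le> 1" if "x \<in> V" for x using that by (simp add: abs_le_iff minus_le_iff)
    then have "w x \<in> S x" for x by (cases "x \<in> V") (auto simp: S_def, simp add: w_def)
    then have "w \<in> K" using Nw by (simp add: K_def PiE_iff)
    then have "q w \<le> q v" by (rule v)
    moreover have "q w = q u / r\<^sup>2"
      unfolding q_def w_def by (simp add: sum_divide_distrib power2_eq_square)
    ultimately show ?thesis using r pos by (simp add: divide_le_eq)
  qed
  have eig: "(\<Sum>y\<in>V. a x y * v y) = q v * v x" if x: "x \<in> V" for x
  proof -
    \<comment> \<open>\<open>v\<close> is moved by \<open>t\<close> in coordinate \<open>x\<close>.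
      The inequality \<open>le\<close> is an equality at \<open>t = 0\<close>, and its linear term
      in \<open>t\<close> is twice the defect of the eigenvalue equation at
      \<open>x\<close>.\<close>
    have ge: "0 \<le> 2 * t * (q v * v x - (\<Sum>y\<in>V. a x y * v y)) + t\<^sup>2 * (q v - a x x)" for t
    proof -
      define e where "e y = (if y = x then 1 else 0::real)" for y
      have eq1: "(\<Sum>y\<in>V. f y * e y) = f x" for f
        using x V by (simp add: e_def if_distrib cong: if_cong)
      have eq2: "(\<Sum>y\<in>V. e y * f y) = f x" for f
        using eq1[of f] by (simp only: mult.commute[of "e _"])
      note eq = eq1 eq2
      have "q (\<lambda>y. v y + t * e y) = q v + t * (\<Sum>z\<in>V. \<Sum>y\<in>V. a z y * v z * e y)
        + t * (\<Sum>z\<in>V. e z * (\<Sum>y\<in>V. a z y * v y)) + t\<^sup>2 * (\<Sum>z\<in>V. e z * (\<Sum>y\<in>V. a z y * e y))"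
        unfolding q_def by (simp add: algebra_simps sum.distrib sum_distrib_left power2_eq_square)
      also have "\<dots> = q v + 2 * t * (\<Sum>y\<in>V. a x y * v y) + t\<^sup>2 * a x x"
      proof -
        have "(\<Sum>z\<in>V. a z x * v z) = (\<Sum>z\<in>V. a x z * v z)"
          by (rule sum.cong[OF refl], subst sym, rule refl)
        then show ?thesis unfolding eq by simp
      qed
      finally have 1: "q (\<lambda>y. v y + t * e y) = q v + 2 * t * (\<Sum>y\<in>V. a x y * v y) + t\<^sup>2 * a x x" .
      have "N (\<lambda>y. v y + t * e y) = N v + 2 * t * (\<Sum>y\<in>V. v y * e y) + t\<^sup>2 * (\<Sum>y\<in>V. e y * e y)"
        unfolding N_def by (simp add: algebra_simps sum.distrib sum_distrib_left power2_eq_square)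
      also have "\<dots> = 1 + 2 * t * v x + t\<^sup>2"
        unfolding eq Nv by (simp add: e_def)
      finally have 2: "N (\<lambda>y. v y + t * e y) = 1 + 2 * t * v x + t\<^sup>2" .
      show ?thesis using le[of "\<lambda>y. v y + t * e y"] unfolding 1 2 by (simp add: algebra_simps)
    qed
    show ?thesis using linear_coeff_zero[OF ge] by simp
  qed
  have "\<exists>x\<in>V. v x \<noteq> 0"
  proof (rule ccontr)
    assume "\<not> ?thesis"
    then have "N v = 0" by (simp add: N_def)
    then show False using Nv by simp
  qed
  from that[OF this eig] le show thesis unfolding q_def N_def by blast
qed

text \<open>The maximum \<open>m\<close> of the Rayleigh quotient is an eigenvalue of the adjacency
  matrix, hence below \<open>r\<close>. The sum over arcs is the full form of that matrix: every
  edge enters twice.\<close>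

lemma quadratic_form_less_of_spectral_radius_less:
  fixes G :: "'a pair_pre_digraph" and u :: "'a \<Rightarrow> real"
  assumes G: "pair_graph G" and rho: "graph_spectral_radius G < r" and u: "\<exists>x\<in>pverts G. u x \<noteq> 0"
  shows "(\<Sum>(x, y)\<in>parcs G. u x * u y) < r * (\<Sum>x\<in>pverts G. (u x)\<^sup>2)"
proof -
  interpret pair_graph G by (rule G)
  let ?V = "pverts G" and ?A = "adjacency_matrix G" and ?n = "card (pverts G)"
  define a where "a x y = (if (x, y) \<in> parcs G then 1 else 0::real)" for x y
  have sym: "a x y = a y x" for x y
    using arcs_symmetric[of x y] arcs_symmetric[of y x] by (auto simp: a_def)
  have V: "finite ?V" "?V \<noteq> {}" using u by auto
  obtain m v where v: "\<exists>x\<in>?V. v x \<noteq> 0" "\<And>x. x \<in> ?V \<Longrightarrow> (\<Sum>y\<in>?V. a x y * v y) = m * v x"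
    and le: "\<And>u. (\<Sum>x\<in>?V. \<Sum>y\<in>?V. a x y * (u x * u y)) \<le> m * (\<Sum>x\<in>?V. (u x)\<^sup>2)"
    by (rule symmetric_form_max_eigenvector[of ?V a, OF V sym]) blast
  define e where "e = vertex_enum G"
  have bij: "bij_betw e {..<?n} ?V"
    unfolding e_def vertex_enum_def
    by (rule someI_ex[where P = "\<lambda>f. bij_betw f {..<?n} ?V"]) (use ex_bij_betw_nat_finite[OF V(1)] in \<open>simp add: atLeast0LessThan\<close>)
  have A: "?A \<in> carrier_mat ?n ?n" by (simp add: adjacency_matrix_def)
  define w where "w = vec ?n (\<lambda>i. v (e i))"
  have "?A *\<^sub>v w = m \<cdot>\<^sub>v w"
  proof (rule eq_vecI)
    fix i assume "i < dim_vec (m \<cdot>\<^sub>v w)"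
    then have i: "i < ?n" by (simp add: w_def)
    have "(?A *\<^sub>v w) $ i = (\<Sum>j<?n. a (e i) (e j) * v (e j))"
      using i by (simp add: adjacency_matrix_def w_def scalar_prod_def a_def e_def atLeast0LessThan)
    also have "\<dots> = (\<Sum>y\<in>?V. a (e i) y * v y)"
      using sum.reindex_bij_betw[OF bij, of "\<lambda>y. a (e i) y * v y"] .
    also have "\<dots> = m * v (e i)" using i bij by (intro v) (auto simp: bij_betw_def)
    finally show "(?A *\<^sub>v w) $ i = (m \<cdot>\<^sub>v w) $ i" using i by (simp add: w_def)
  qed (simp add: w_def adjacency_matrix_def)
  moreover have "w \<noteq> 0\<^sub>v ?n"
  proof
    assume w0: "w = 0\<^sub>v ?n"
    obtain x where x: "x \<in> ?V" "v x \<noteq> 0" using v by blast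
    then have "x \<in> e ` {..<?n}" using bij by (simp add: bij_betw_def)
    then obtain i where "i < ?n" "e i = x" by auto
    then show False using x arg_cong[OF w0, of "\<lambda>w. w $ i"] by (simp add: w_def)
  qed
  ultimately have "eigenvalue ?A m" unfolding eigenvalue_def eigenvector_def
    by (intro exI[of _ w]) (simp add: w_def adjacency_matrix_def)
  then have "m \<le> Max (spectrum ?A)"
    using card_finite_spectrum(1)[OF A] by (intro Max_ge) (auto simp: spectrum_def)
  then have m: "m < r" using rho by (simp add: graph_spectral_radius_def)
  have "(\<Sum>x\<in>?V. (u x)\<^sup>2) > 0" using u by (auto intro!: sum_pos2)
  have "(\<Sum>(x, y)\<in>parcs G. u x * u y) = (\<Sum>(x, y)\<in>?V \<times> ?V. a x y * (u x * u y))"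
    by (rule sum.mono_neutral_cong_left) (auto simp: a_def dest: in_arcsD1 in_arcsD2)
  also have "\<dots> = (\<Sum>x\<in>?V. \<Sum>y\<in>?V. a x y * (u x * u y))"
    by (simp add: sum.cartesian_product)
  also have "\<dots> \<le> m * (\<Sum>x\<in>?V. (u x)\<^sup>2)" by (rule le)
  also have "\<dots> < r * (\<Sum>x\<in>?V. (u x)\<^sup>2)"
    using m \<open>(\<Sum>x\<in>?V. (u x)\<^sup>2) > 0\<close> by simp
  finally show ?thesis .
qed

section \<open>The tridiagonal form on the spine\<close>

text \<open>Eliminating a pendent path of length \<open>m\<close> from the form \<open>3/\<surd>2 - A\<close> leaves the diagonal entry
  \<open>(2 + arm_excess m) / \<surd>2\<close> at the vertex carrying it.\<close>

definition arm_excess :: "nat \<Rightarrow> real" where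
  "arm_excess m = 1 / (2 ^ Suc m - 1)"

text \<open>Eliminating the spine vertices \<open>0, \<dots>, x - 1\<close> from \<open>spine_form\<close> below turns the diagonal entry
  \<open>2 + arm_excess (h x)\<close> at \<open>x\<close> into the pivot \<open>1 + spine_excess h x + arm_excess (h x)\<close>. A bare path
  of length \<open>x\<close> gives \<open>arm_excess x\<close>, an infinite path would give \<open>0\<close>.\<close>

fun spine_excess :: "(nat \<Rightarrow> nat) \<Rightarrow> nat \<Rightarrow> real" where
  "spine_excess h 0 = 1"
| "spine_excess h (Suc x) = 1 - 2 / (1 + spine_excess h x + arm_excess (h x))"

text \<open>This is \<open>sqrt 2\<close> times what remains of the form
  \<open>3 / sqrt 2 - A\<close> on the spine once all hanging paths have been eliminated.\<close>

definition spine_form :: "nat \<Rightarrow> (nat \<Rightarrow> nat) \<Rightarrow> (nat \<Rightarrow> real) \<Rightarrow> real" where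
  "spine_form L h U = (\<Sum>x\<le>L. (2 + arm_excess (h x)) * (U x)\<^sup>2) - 2 * sqrt 2 * (\<Sum>x<L. U x * U (Suc x))"

definition spine_pos_def :: "nat \<Rightarrow> (nat \<Rightarrow> nat) \<Rightarrow> bool" where
  "spine_pos_def L h \<longleftrightarrow> (\<forall>U. (\<exists>x\<le>L. U x \<noteq> 0) \<longrightarrow> 0 < spine_form L h U)"

section \<open>Recursions for the excesses and reversal of the spine\<close>

lemma arm_excess_0 [simp]: "arm_excess 0 = 1"
  by (simp add: arm_excess_def)

lemma arm_excess_pos: "0 < arm_excess m"
proof -
  have "(2::real) ^ Suc m > 1" by (rule one_less_power) auto
  then show ?thesis by (simp add: arm_excess_def)
qed

lemma arm_excess_le_1: "arm_excess m \<le> 1"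
proof -
  have "(2::real) ^ m \<ge> 1" by simp
  then show ?thesis by (simp add: arm_excess_def divide_simps)
qed

text \<open>A new foot below a vertex with diagonal entry \<open>(2 + e) / sqrt 2\<close> gets the
  entry \<open>3 / sqrt 2 - sqrt 2 / (2 + e)\<close>; the equation is this elimination step after
  normalisation.\<close>

lemma arm_excess_Suc: "arm_excess (Suc m) = 1 - 2 / (2 + arm_excess m)"
proof -
  define M where "M = (2::real) ^ m"
  have M: "2 * M - 1 > 0" "4 * M - 1 > 0" unfolding M_def using one_le_power[of "2::real" m] by linarith+
  have "2 + 1 / (2 * M - 1) = (4 * M - 1) / (2 * M - 1)" using M by (simp add: field_simps)
  then have "1 / (4 * M - 1) = 1 - 2 / (2 + 1 / (2 * M - 1))" using M by (simp add: field_simps)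
  then show ?thesis by (simp add: arm_excess_def M_def)
qed

text \<open>Since \<open>arm_excess 0 = 1\<close>, both sides start at \<open>1\<close> and follow
  the recursion of \<open>arm_excess_Suc\<close>: the bare beginning of the spine is itself an
  arm.\<close>

lemma spine_excess_before_branch:
  "(\<And>j. j < x \<Longrightarrow> h j = 0) \<Longrightarrow> spine_excess h x = arm_excess x"
  by (induction x) (auto simp: arm_excess_Suc)

text \<open>Reading the spine backwards preserves the form, so every bound obtained from the left
  end is also available from the right end.\<close>

lemma spine_form_reflect:
  "spine_form L (\<lambda>x. h (L - x)) (\<lambda>x. U (L - x)) = spine_form L h U"
proof -
  have 1: "(\<Sum>x\<le>L. (2 + arm_excess (h (L - x))) * (U (L - x))\<^sup>2) = (\<Sum>x\<le>L. (2 + arm_excess (h x)) * (U x)\<^sup>2)"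
    by (rule sum.reindex_bij_witness[of _ "\<lambda>x. L - x" "\<lambda>x. L - x"]) auto
  have 2: "(\<Sum>x<L. U (L - x) * U (L - Suc x)) = (\<Sum>x<L. U x * U (Suc x))"
    by (rule sum.reindex_bij_witness[of _ "\<lambda>x. L - Suc x" "\<lambda>x. L - Suc x"])
      (auto simp: Suc_diff_Suc mult.commute)
  show ?thesis unfolding spine_form_def 1 2 ..
qed

lemma spine_pos_def_reflect:
  assumes "spine_pos_def L h"
  shows "spine_pos_def L (\<lambda>x. h (L - x))"
  unfolding spine_pos_def_def
proof (intro allI impI)
  fix U :: "nat \<Rightarrow> real"
  assume "\<exists>x\<le>L. U x \<noteq> 0"
  then obtain x where "x \<le> L" "U x \<noteq> 0" by blast
  then have "\<exists>x\<le>L. U (L - x) \<noteq> 0" by (intro exI[of _ "L - x"]) simp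
  then have "0 < spine_form L h (\<lambda>x. U (L - x))"
    using assms[unfolded spine_pos_def_def, rule_format, of "\<lambda>x. U (L - x)"] by simp
  also have "\<dots> = spine_form L (\<lambda>x. h (L - x)) (\<lambda>x. U (L - (L - x)))"
    by (rule spine_form_reflect[symmetric])
  also have "\<dots> = spine_form L (\<lambda>x. h (L - x)) U"
    unfolding spine_form_def by (intro arg_cong2[where f = "(-)"] arg_cong2[where f = "(*)"] sum.cong) auto
  finally show "0 < spine_form L (\<lambda>x. h (L - x)) U" .
qed

section \<open>Pivots of the elimination and their positivity\<close>

text \<open>Gaussian elimination as an explicit vector: \<open>U\<close> chooses the earlier
  coordinates so as to minimise the partial form under \<open>U a = 1\<close>. Adding the diagonal
  entry \<open>2 + arm_excess (h a)\<close> turns the value into the pivot at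
  \<open>a\<close>.\<close>

lemma spine_minimiser:
  assumes "\<And>x. x < a \<Longrightarrow> 0 < 1 + spine_excess h x + arm_excess (h x)"
  shows "\<exists>U. U a = 1 \<and>
    (\<Sum>x<a. (2 + arm_excess (h x)) * (U x)\<^sup>2) - 2 * sqrt 2 * (\<Sum>x<a. U x * U (Suc x)) = spine_excess h a - 1"
  using assms
proof (induction a)
  case 0
  show ?case by (intro exI[of _ "\<lambda>_. 1"]) simp
next
  case (Suc a)
  define d where "d = 1 + spine_excess h a + arm_excess (h a)"
  have d: "d > 0" unfolding d_def using Suc.prems by simp
  obtain U where U: "U a = 1"
    "(\<Sum>x<a. (2 + arm_excess (h x)) * (U x)\<^sup>2) - 2 * sqrt 2 * (\<Sum>x<a. U x * U (Suc x)) = spine_excess h a - 1"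
    using Suc.IH[OF Suc.prems[OF less_SucI]] by blast
  \<comment> \<open>This scaling of the old minimiser minimises
    \<open>c * c * d - 2 * sqrt 2 * c\<close>; the minimum is \<open>- 2 / d\<close>.\<close>
  define c where "c = sqrt 2 / d"
  define U' where "U' = (\<lambda>x. if x \<le> a then c * U x else 1)"
  have 1: "(\<Sum>x<a. (2 + arm_excess (h x)) * (U' x)\<^sup>2) = c\<^sup>2 * (\<Sum>x<a. (2 + arm_excess (h x)) * (U x)\<^sup>2)"
    by (auto simp: sum_distrib_left U'_def power_mult_distrib intro!: sum.cong)
  have 2: "(\<Sum>x<a. U' x * U' (Suc x)) = c\<^sup>2 * (\<Sum>x<a. U x * U (Suc x))"
    by (auto simp: sum_distrib_left U'_def power2_eq_square intro!: sum.cong)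
  have "(\<Sum>x<Suc a. (2 + arm_excess (h x)) * (U' x)\<^sup>2) - 2 * sqrt 2 * (\<Sum>x<Suc a. U' x * U' (Suc x))
    = c\<^sup>2 * ((\<Sum>x<a. (2 + arm_excess (h x)) * (U x)\<^sup>2) - 2 * sqrt 2 * (\<Sum>x<a. U x * U (Suc x)))
      + (2 + arm_excess (h a)) * c\<^sup>2 - 2 * sqrt 2 * c"
    unfolding sum.lessThan_Suc 1 2 by (simp add: U'_def U(1) algebra_simps)
  also have "\<dots> = c\<^sup>2 * d - 2 * sqrt 2 * c"
    unfolding U(2) d_def by (simp add: algebra_simps)
  also have "\<dots> = - 2 / d"
    using d by (simp add: c_def power2_eq_square field_simps)
  also have "\<dots> = spine_excess h (Suc a) - 1"
    by (simp add: d_def)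
  finally show ?case by (intro exI[of _ U']) (simp add: U'_def)
qed

text \<open>By induction the earlier pivots are positive, so the minimiser up to \<open>a\<close>
  exists. Extended by zero to the right, it gives \<open>spine_form\<close> the pivot at
  \<open>a\<close> as its value.\<close>

lemma spine_pivot_pos:
  assumes "spine_pos_def L h" "a \<le> L"
  shows "0 < 1 + spine_excess h a + arm_excess (h a)"
  using assms(2)
proof (induction a rule: less_induct)
  case (less a)
  then obtain U where U: "U a = 1"
    "(\<Sum>x<a. (2 + arm_excess (h x)) * (U x)\<^sup>2) - 2 * sqrt 2 * (\<Sum>x<a. U x * U (Suc x)) = spine_excess h a - 1"
    using spine_minimiser[of a h] by auto
  define V where "V x = (if x \<le> a then U x else 0)" for x
  have "\<exists>x\<le>L. V x \<noteq> 0" using U less.prems by (auto simp: V_def intro!: exI[of _ a])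
  then have "0 < spine_form L h V" using assms by (simp add: spine_pos_def_def)
  also have "(\<Sum>x\<le>L. (2 + arm_excess (h x)) * (V x)\<^sup>2) = (\<Sum>x<Suc a. (2 + arm_excess (h x)) * (U x)\<^sup>2)"
    using less.prems by (intro sum.mono_neutral_cong_right) (auto simp: V_def)
  then have "spine_form L h V = (\<Sum>x<a. (2 + arm_excess (h x)) * (U x)\<^sup>2) + (2 + arm_excess (h a))
      - 2 * sqrt 2 * (\<Sum>x<L. V x * V (Suc x))"
    by (simp add: spine_form_def U)
  also have "(\<Sum>x<L. V x * V (Suc x)) = (\<Sum>x<a. U x * U (Suc x))"
    using less.prems by (intro sum.mono_neutral_cong_right) (auto simp: V_def)
  finally show ?case using U(2) by simp
qed

text \<open>The minimisers from the two ends are glued at \<open>a\<close>, where both equal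
  \<open>1\<close>. Their values, each an excess minus \<open>1\<close>, and the diagonal entry
  \<open>2 + arm_excess (h a)\<close> add up to the stated sum.\<close>

lemma spine_excess_sum_pos:
  assumes "spine_pos_def L h" "a \<le> L"
  shows "0 < spine_excess h a + spine_excess (\<lambda>x. h (L - x)) (L - a) + arm_excess (h a)"
proof -
  let ?h = "\<lambda>x. h (L - x)"
  obtain U where U: "U a = 1"
    "(\<Sum>x<a. (2 + arm_excess (h x)) * (U x)\<^sup>2) - 2 * sqrt 2 * (\<Sum>x<a. U x * U (Suc x)) = spine_excess h a - 1"
    using spine_minimiser[of a h] spine_pivot_pos[OF assms(1)] assms(2) by auto
  obtain U' where U': "U' (L - a) = 1"
    "(\<Sum>x<L-a. (2 + arm_excess (?h x)) * (U' x)\<^sup>2) - 2 * sqrt 2 * (\<Sum>x<L-a. U' x * U' (Suc x)) = spine_excess ?h (L-a) - 1"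
    using spine_minimiser[of "L - a" ?h] spine_pivot_pos[OF spine_pos_def_reflect[OF assms(1)]] by auto
  define V where "V x = (if x \<le> a then U x else U' (L - x))" for x
  have "\<exists>x\<le>L. V x \<noteq> 0" using U assms by (auto simp: V_def intro!: exI[of _ a])
  then have pos: "0 < spine_form L h V" using assms by (simp add: spine_pos_def_def)
  have "(\<Sum>x\<le>L. (2 + arm_excess (h x)) * (V x)\<^sup>2)
     = (\<Sum>x\<le>a. (2 + arm_excess (h x)) * (V x)\<^sup>2) + (\<Sum>x\<in>{a<..L}. (2 + arm_excess (h x)) * (V x)\<^sup>2)"
    using assms by (subst sum.union_disjoint[symmetric]) (auto simp: ivl_disj_un)
  also have "(\<Sum>x\<le>a. (2 + arm_excess (h x)) * (V x)\<^sup>2)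
     = (\<Sum>x<a. (2 + arm_excess (h x)) * (V x)\<^sup>2) + (2 + arm_excess (h a)) * (V a)\<^sup>2"
    by (simp add: lessThan_Suc_atMost[symmetric])
  also have "(\<Sum>x<a. (2 + arm_excess (h x)) * (V x)\<^sup>2) = (\<Sum>x<a. (2 + arm_excess (h x)) * (U x)\<^sup>2)"
    by (auto simp: V_def intro!: sum.cong)
  also have "(\<Sum>x\<in>{a<..L}. (2 + arm_excess (h x)) * (V x)\<^sup>2) = (\<Sum>x<L-a. (2 + arm_excess (?h x)) * (U' x)\<^sup>2)"
    by (rule sum.reindex_bij_witness[of _ "\<lambda>x. L - x" "\<lambda>x. L - x"]) (auto simp: V_def)
  also have "V a = 1" by (simp add: V_def U)
  finally have *: "0 < (\<Sum>x<a. (2 + arm_excess (h x)) * (U x)\<^sup>2) + (2 + arm_excess (h a))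
      + (\<Sum>x<L-a. (2 + arm_excess (?h x)) * (U' x)\<^sup>2) - 2 * sqrt 2 * (\<Sum>x<L. V x * V (Suc x))"
    using pos by (simp add: spine_form_def)
  have "(\<Sum>x<L. V x * V (Suc x)) = (\<Sum>x<a. V x * V (Suc x)) + (\<Sum>x\<in>{a..<L}. V x * V (Suc x))"
    unfolding lessThan_atLeast0 using assms by (simp add: sum.atLeastLessThan_concat)
  also have "(\<Sum>x<a. V x * V (Suc x)) = (\<Sum>x<a. U x * U (Suc x))"
    by (auto simp: V_def intro!: sum.cong)
  also have "(\<Sum>x\<in>{a..<L}. V x * V (Suc x)) = (\<Sum>x<L-a. U' x * U' (Suc x))"
    using U U' by (intro sum.reindex_bij_witness[of _ "\<lambda>x. L - Suc x" "\<lambda>x. L - Suc x"])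
       (auto simp: V_def Suc_diff_Suc le_less)
  finally show ?thesis using U(2) U'(2) * by (simp add: algebra_simps)
qed


section \<open>Upper bounds for the excess behind branch vertices\<close>

text \<open>With \<open>Y\<close> the excess plus arm excess at \<open>x\<close>, the next excess
  \<open>1 - 2 / (1 + Y)\<close> equals \<open>- 1 / (1 + D)\<close> for
  \<open>D = 2 * Y / (1 - Y)\<close>. It increases with \<open>Y\<close>, so an upper bound
  \<open>X\<close> suffices.\<close>

lemma spine_excess_Suc_le:
  assumes "spine_pos_def L h" "x < L" "spine_excess h x + arm_excess (h x) \<le> X" "X < 1"
    and "2 * X / (1 - X) \<le> D"
  shows "spine_excess h (Suc x) \<le> - 1 / (1 + D)"
proof -
  let ?Y = "spine_excess h x + arm_excess (h x)"
  have Y: "0 < 1 + ?Y" using spine_pivot_pos[of L h x] assms by simp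
  have X: "0 < 1 + X" using Y assms by simp
  have "1 + 2 * X / (1 - X) = (1 + X) / (1 - X)" using assms by (simp add: field_simps)
  moreover have "(1 + X) / (1 - X) > 0" using X assms by simp
  moreover define z where "z = (1 + X) / (1 - X)"
  ultimately have D: "0 < z" "z \<le> 1 + D" using assms by auto
  have "spine_excess h (Suc x) = 1 - 2 / (1 + ?Y)" by (simp add: add.assoc)
  also have "\<dots> \<le> 1 - 2 / (1 + X)"
    using Y X assms by (simp add: frac_le)
  also have "\<dots> = - 1 / z"
    using X assms by (simp add: z_def field_simps)
  also have "\<dots> \<le> - 1 / (1 + D)"
    using D by (simp add: frac_le)
  finally show ?thesis .
qed

text \<open>A bare vertex has arm excess \<open>1\<close>, so an excess \<open>- 1 / (1 + D)\<close>
  gives \<open>Y = D / (1 + D)\<close> and \<open>2 * Y / (1 - Y) = 2 * D\<close>: each bare vertex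
  doubles \<open>D\<close>.\<close>

lemma spine_excess_along_path:
  assumes "spine_pos_def L h" "0 < D" "spine_excess h x \<le> - 1 / (1 + D)"
    and "\<And>j. x \<le> j \<Longrightarrow> j < x + k \<Longrightarrow> h j = 0" "x + k \<le> L"
  shows "spine_excess h (x + k) \<le> - 1 / (1 + 2 ^ k * D)"
  using assms(4,5)
proof (induction k)
  case 0
  then show ?case using assms by simp
next
  case (Suc k)
  let ?D = "2 ^ k * D"
  have D: "?D > 0" using assms by simp
  have "spine_excess h (x + k) \<le> - 1 / (1 + ?D)" using Suc by auto
  moreover have "h (x + k) = 0" using Suc by auto
  moreover have "1 - 1 / (1 + ?D) = ?D / (1 + ?D)"
    using D by (simp add: field_simps)
  ultimately have 1: "spine_excess h (x + k) + arm_excess (h (x + k)) \<le> ?D / (1 + ?D)" by simp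
  have 2: "?D / (1 + ?D) < 1" using D by simp
  have "1 - ?D / (1 + ?D) = 1 / (1 + ?D)" using D by (simp add: field_simps)
  then have 3: "2 * (?D / (1 + ?D)) / (1 - ?D / (1 + ?D)) \<le> 2 ^ Suc k * D"
    using D by simp
  show ?case using spine_excess_Suc_le[OF assms(1) _ 1 2 3] Suc.prems by simp
qed

text \<open>The bare stretch before \<open>a\<close> acts as an arm at least as long as the one
  hanging at \<open>a\<close>, so excess plus arm excess is at most
  \<open>2 * arm_excess (h a)\<close>. With \<open>P = 2 ^ h a\<close> this is
  \<open>2 / (2 * P - 1)\<close>, which leads to \<open>D = 4 / (2 * P - 3)\<close>.\<close>

lemma spine_excess_after_first_branch:
  assumes "spine_pos_def L h" "a < L" "\<And>j. j < a \<Longrightarrow> h j = 0" "0 < h a" "h a \<le> a"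
  shows "spine_excess h (Suc a) \<le> - 1 / (1 + 4 / (2 * 2 ^ h a - 3))"
proof -
  define P :: real where "P = 2 ^ h a"
  have "P \<ge> 2 ^ 1" unfolding P_def using assms by (intro power_increasing) auto
  then have P: "P \<ge> 2" by simp
  have "P \<le> 2 ^ a" unfolding P_def using assms by (intro power_increasing) auto
  then have "arm_excess a \<le> 1 / (2 * P - 1)" using P by (simp add: arm_excess_def frac_le)
  moreover have "arm_excess (h a) = 1 / (2 * P - 1)" by (simp add: arm_excess_def P_def)
  ultimately have 1: "spine_excess h a + arm_excess (h a) \<le> 2 / (2 * P - 1)"
    using spine_excess_before_branch[of a h] assms by simp
  have 2: "2 / (2 * P - 1) < 1" using P by simp
  define A where "A = 2 * P - 1"
  have "1 - 2 / A = (A - 2) / A" "A \<noteq> 0" using P by (simp_all add: A_def field_simps)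
  then have "2 * (2 / A) / (1 - 2 / A) \<le> 4 / (A - 2)" by simp
  then have 3: "2 * (2 / (2 * P - 1)) / (1 - 2 / (2 * P - 1)) \<le> 4 / (2 * P - 3)"
    by (simp add: A_def)
  show ?thesis using spine_excess_Suc_le[OF assms(1,2) 1 2 3] by (simp add: P_def)
qed


lemma spine_excess_le_1:
  assumes "spine_pos_def L h" "x \<le> L"
  shows "spine_excess h x \<le> 1"
  using spine_pivot_pos[OF assms(1), of "x - 1"] assms(2) by (cases x) auto

lemma arm_excess_le_third: "0 < m \<Longrightarrow> arm_excess m \<le> 1 / 3"
proof (cases m)
  case (Suc k)
  have "(2::real) ^ k \<ge> 1" by simp
  then show ?thesis by (simp add: Suc arm_excess_def divide_simps)
qed simp

text \<open>The next excess is nonpositive exactly when excess plus arm excess is at most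
  \<open>1\<close>. At \<open>a\<close> both are at most \<open>1 / 3\<close>; afterwards a
  nonpositive excess tolerates any arm excess, which never exceeds \<open>1\<close>.\<close>

lemma spine_excess_nonpos:
  assumes "spine_pos_def L h" "0 < a" "0 < h a" "a < x" "x \<le> L"
  shows "spine_excess h x \<le> 0"
  using assms(4,5)
proof (induction x)
  case (Suc x)
  have "spine_excess h x + arm_excess (h x) \<le> 1"
  proof (cases "x = a")
    case True
    \<comment> \<open>The predecessor of \<open>a\<close> has pivot at most \<open>3\<close>, so the
      excess at \<open>a\<close> is at most \<open>1 - 2 / 3\<close>.\<close>
    obtain y where y: "a = Suc y" using assms(2) by (cases a) auto
    have "0 < 1 + spine_excess h y + arm_excess (h y)" "1 + spine_excess h y + arm_excess (h y) \<le> 3"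
      using spine_pivot_pos[OF assms(1), of y] spine_excess_le_1[OF assms(1), of y] arm_excess_le_1[of "h y"] Suc.prems y
      by auto
    then have "2 / 3 \<le> 2 / (1 + spine_excess h y + arm_excess (h y))" by (intro frac_le) auto
    then have "spine_excess h a \<le> 1 / 3" by (simp add: y)
    then show ?thesis using arm_excess_le_third[OF assms(3)] True by simp
  next
    case False
    then show ?thesis using Suc arm_excess_le_1[of "h x"] by simp
  qed
  moreover have "0 < 1 + spine_excess h x + arm_excess (h x)"
    using spine_pivot_pos[OF assms(1), of x] Suc.prems by simp
  ultimately show ?case by (simp add: field_simps)
qed simp

text \<open>The weight \<open>4 * 2^x / 4^(\<Sum>j<x. h j)\<close> doubles along the spine and loses a factor \<open>4\<close> for
  every vertex of a hanging path, so comparing it with \<open>1\<close> at the end of the spine is the inequality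
  \<open>2 * (\<Sum>x\<le>L. h x) \<le> L + 2\<close>.\<close>

lemma spine_excess_weight_bound:
  assumes pos: "spine_pos_def L h"
    and a: "\<And>j. j < a \<Longrightarrow> h j = 0" "0 < h a" "h a \<le> a"
    and b: "0 < h b" "b < L" and x: "a < x" "x \<le> b"
  shows "spine_excess h x \<le> - 1 / (1 + 4 * 2 ^ x / 4 ^ (\<Sum>j<x. h j))"
proof -
  have "Suc a \<le> x" using x by simp
  from this x(2) show ?thesis
  proof (induction x rule: dec_induct)
    case base
    \<comment> \<open>Only the arm at \<open>a\<close> has been charged so far. Using
      \<open>h a \<le> a\<close> and \<open>P \<ge> 2\<close>, the weight is at least
      \<open>8 / P\<close>, hence at least the value \<open>4 / (2 * P - 3)\<close> found after the
      first branch.\<close>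
    define P :: real where "P = 2 ^ h a"
    have "P \<ge> 2 ^ 1" unfolding P_def using a by (intro power_increasing) auto
    then have P: "P \<ge> 2" by simp
    have K: "P \<le> 2 ^ a" unfolding P_def using a by (intro power_increasing) auto
    have "(\<Sum>j<Suc a. h j) = h a" using a by simp
    moreover have "(4::real) ^ h a = P * P" by (simp add: P_def flip: power_mult_distrib)
    ultimately have "4 * 2 ^ Suc a / 4 ^ (\<Sum>j<Suc a. h j) = 8 * 2 ^ a / (P * P)" by simp
    moreover have "8 * P / (P * P) \<le> 8 * 2 ^ a / (P * P)" using K P by (intro divide_right_mono) auto
    moreover have "8 * P / (P * P) = 8 / P" using P by simp
    moreover have "4 / (2 * P - 3) \<le> 8 / P" using P by (simp add: field_simps)
    ultimately have W: "4 / (2 * P - 3) \<le> 4 * 2 ^ Suc a / 4 ^ (\<Sum>j<Suc a. h j)" by linarith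
    have "spine_excess h (Suc a) \<le> - 1 / (1 + 4 / (2 * P - 3))"
      unfolding P_def using spine_excess_after_first_branch[OF pos _ a] x b by simp
    also have "\<dots> \<le> - 1 / (1 + 4 * 2 ^ Suc a / 4 ^ (\<Sum>j<Suc a. h j))"
    proof -
      define z where "z = 4 / (2 * P - 3)"
      have "z > 0" using P by (simp add: z_def)
      then show ?thesis using W unfolding z_def[symmetric]
        by (simp add: frac_le del: power_Suc sum.lessThan_Suc)
    qed
    finally show ?case .
  next
    case (step x)
    define W :: real where "W = 4 * 2 ^ x / 4 ^ (\<Sum>j<x. h j)"
    have W: "W > 0" by (simp add: W_def)
    have E: "spine_excess h x \<le> - 1 / (1 + W)" using step by (simp add: W_def)
    have W': "4 * 2 ^ Suc x / 4 ^ (\<Sum>j<Suc x. h j) = 2 * W / 4 ^ h x"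
      by (simp add: W_def power_add)
    show ?case
    proof (cases "h x = 0")
      case True
      then show ?thesis
        using spine_excess_along_path[OF pos W E, of 1] step.hyps step.prems W' b
        by (auto simp: less_Suc_eq)
    next
      case False
      define M :: real where "M = 2 ^ h x"
      have "M \<ge> 2 ^ 1" unfolding M_def using False by (intro power_increasing) auto
      then have M: "M \<ge> 2" by simp
      have MM: "(4::real) ^ h x = M * M" by (simp add: M_def flip: power_mult_distrib)
      have e: "arm_excess (h x) = 1 / (2 * M - 1)" by (simp add: arm_excess_def M_def)
      \<comment> \<open>The branch at \<open>b\<close> still lies to the right of \<open>x\<close>,
        so the excess from that side is nonpositive, and the left excess plus the arm excess must be
        positive. This bounds \<open>W\<close> from below.\<close>
      have "spine_excess (\<lambda>x. h (L - x)) (L - x) \<le> 0"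
        using b step by (intro spine_excess_nonpos[OF spine_pos_def_reflect[OF pos], of "L - b"]) auto
      then have "0 < spine_excess h x + arm_excess (h x)"
        using spine_excess_sum_pos[OF pos, of x] step b by simp
      then have "1 / (1 + W) < 1 / (2 * M - 1)" using E e by simp
      then have WM: "W > 2 * M - 2" using W M by (simp add: field_simps)
      have 1: "spine_excess h x + arm_excess (h x) \<le> 1 / (2 * M - 1)"
        using E e W by (simp add: order_trans[OF E])
      have 2: "1 / (2 * M - 1) < 1" using M by simp
      define A B where "A = 2 * M - 1" and "B = 2 * M - 2"
      have "1 - 1 / A = B / A" "A \<noteq> 0" using M by (simp_all add: A_def B_def field_simps)
      then have "2 * (1 / A) / (1 - 1 / A) = 2 / B" by simp
      \<comment> \<open>Expanding by \<open>B\<close> brings in both \<open>B < W\<close> for the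
        numerator and \<open>M \<le> B\<close> for the denominator, which produces the weight
        reduced by \<open>4 ^ h x\<close>.\<close>
      also have "2 / B = 2 * B / (B * B)" by simp
      also have "\<dots> \<le> 2 * W / (M * M)"
        using M WM by (intro frac_le mult_mono) (auto simp: B_def)
      finally have 3: "2 * (1 / (2 * M - 1)) / (1 - 1 / (2 * M - 1)) \<le> 2 * W / (M * M)"
        by (simp add: A_def)
      show ?thesis unfolding W' MM
        using spine_excess_Suc_le[OF pos _ 1 2 3] step b by simp
    qed
  qed
qed

section \<open>Three or more branch vertices\<close>

text \<open>Measured from \<open>c = 2 * M - 1\<close>, with \<open>1 + W = s + c\<close> and
  \<open>1 + W' = t + c\<close>, the hypothesis says \<open>s * t > c * c\<close>. The inequality of
  arithmetic and geometric means gives \<open>s + t > 2 * c\<close>, and expanding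
  \<open>W * W'\<close> bounds it below by the square of \<open>2 * c - 1\<close>.\<close>

lemma product_bound_of_reciprocals:
  fixes W W' M :: real
  assumes "0 < W" "0 < W'" "2 \<le> M" "1 / (1 + W) + 1 / (1 + W') < 1 / (2 * M - 1)"
  shows "4 * (M * M) < W * W'"
proof -
  define c s t where "c = 2 * M - 1" and "s = 1 + W - c" and "t = 1 + W' - c"
  have c: "c \<ge> 3" using assms by (simp add: c_def)
  \<comment> \<open>Each reciprocal alone is already below \<open>1 / c\<close>, which makes
    \<open>s\<close> and \<open>t\<close> positive.\<close>
  have "1 / (1 + W) < 1 / c" "1 / (1 + W') < 1 / c"
    using assms add_pos_pos[of "1 / (1 + W)" "1 / (1 + W')"]
    by (smt (verit) c_def zero_less_divide_1_iff)+
  then have s: "s > 0" and t: "t > 0" using assms c by (auto simp: s_def t_def field_simps)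
  have W: "1 + W = s + c" "1 + W' = t + c" by (simp_all add: s_def t_def)
  have "1 / (s + c) + 1 / (t + c) < 1 / c" using assms(4) by (simp only: W c_def)
  moreover have "1 / (s + c) + 1 / (t + c) = (s + t + 2 * c) / ((s + c) * (t + c))"
    using s t c by (simp add: field_simps)
  ultimately have "(s + t + 2 * c) / ((s + c) * (t + c)) < 1 / c" by simp
  then have "(s + t + 2 * c) * c < (s + c) * (t + c)"
    using s t c by (simp add: divide_less_eq less_divide_eq)
  then have st: "s * t > c * c" by (simp add: algebra_simps)
  have "(s + t)\<^sup>2 > (2 * c)\<^sup>2"
    using zero_le_power2[of "s - t"] st by (simp add: power2_eq_square algebra_simps)
  then have st': "s + t > 2 * c" using power2_less_imp_less[of "2 * c" "s + t"] s t by simp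
  have "W * W' = (s + (c - 1)) * (t + (c - 1))" by (simp add: s_def t_def)
  also have "\<dots> = s * t + (c - 1) * (s + t) + (c - 1) * (c - 1)" by (simp add: algebra_simps)
  also have "\<dots> > c * c + (c - 1) * (2 * c) + (c - 1) * (c - 1)"
    using st st' c by (intro add_less_le_mono add_strict_mono mult_strict_left_mono) auto
  finally have "(2 * c - 1) * (2 * c - 1) < W * W'" by (simp add: algebra_simps)
  moreover have "(2 * M) * (2 * M) \<le> (2 * c - 1) * (2 * c - 1)"
    using assms by (intro mult_mono) (auto simp: c_def)
  ultimately show ?thesis by simp
qed

text \<open>The weights from both ends meet at the middle branch \<open>b\<close>. Their product is
  \<open>16 * 2 ^ L\<close> divided by \<open>4\<close> to the total length of the other arms, and
  positivity at \<open>b\<close> makes it exceed \<open>4 * 4 ^ h b\<close>. Comparing exponents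
  gives the strict bound.\<close>

lemma middle_branch_bound:
  assumes pos: "spine_pos_def L h"
    and a: "\<And>j. j < a \<Longrightarrow> h j = 0" "0 < h a" "h a \<le> a"
    and c: "\<And>j. c < j \<Longrightarrow> j \<le> L \<Longrightarrow> h j = 0" "0 < h c" "h c \<le> L - c"
    and b: "a < b" "b < c" "0 < h b"
  shows "2 * (\<Sum>x\<le>L. h x) < L + 2"
proof -
  let ?h = "\<lambda>x. h (L - x)"
  have cL: "c < L" using c by linarith
  define W :: real where "W = 4 * 2 ^ b / 4 ^ (\<Sum>j<b. h j)"
  define W' :: real where "W' = 4 * 2 ^ (L - b) / 4 ^ (\<Sum>j<L-b. ?h j)"
  define M :: real where "M = 2 ^ h b"
  have "M \<ge> 2 ^ 1" unfolding M_def using b by (intro power_increasing) auto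
  then have M: "M \<ge> 2" by simp
  have WW: "W > 0" "W' > 0" by (simp_all add: W_def W'_def)
  have "spine_excess h b \<le> - 1 / (1 + W)"
    unfolding W_def using b cL by (intro spine_excess_weight_bound[OF pos a(1-3), of b]) auto
  moreover have "spine_excess ?h (L - b) \<le> - 1 / (1 + W')"
    unfolding W'_def
    using a b c cL by (intro spine_excess_weight_bound[OF spine_pos_def_reflect[OF pos], of "L - c" "L - b"]) auto
  moreover have "arm_excess (h b) = 1 / (2 * M - 1)" by (simp add: arm_excess_def M_def)
  ultimately have "4 * (M * M) < W * W'"
    using spine_excess_sum_pos[OF pos, of b] b cL by (intro product_bound_of_reciprocals WW M) simp
  also have "M * M = 4 ^ h b" by (simp add: M_def flip: power_mult_distrib)
  also have "W * W' = 16 * (2 ^ b * 2 ^ (L - b)) / (4 ^ (\<Sum>j<b. h j) * 4 ^ (\<Sum>j<L-b. ?h j))"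
    by (simp add: W_def W'_def)
  also have "2 ^ b * 2 ^ (L - b) = (2::real) ^ L" using b cL by (simp flip: power_add)
  also have "4 ^ (\<Sum>j<b. h j) * 4 ^ (\<Sum>j<L-b. ?h j) = (4::real) ^ ((\<Sum>j<b. h j) + (\<Sum>j<L-b. ?h j))"
    by (simp add: power_add)
  finally have "4 ^ (h b + ((\<Sum>j<b. h j) + (\<Sum>j<L-b. ?h j))) < 4 * (2::real) ^ L"
    by (simp add: field_simps power_add)
  also have "(\<Sum>j<L-b. ?h j) = (\<Sum>j\<in>{b<..L}. h j)"
    by (rule sum.reindex_bij_witness[of _ "\<lambda>x. L - x" "\<lambda>x. L - x"]) auto
  also have "h b + ((\<Sum>j<b. h j) + (\<Sum>j\<in>{b<..L}. h j)) = (\<Sum>x\<le>L. h x)"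
  proof -
    have "(\<Sum>x\<le>L. h x) = (\<Sum>x\<le>b. h x) + (\<Sum>j\<in>{b<..L}. h j)"
      using b cL by (subst sum.union_disjoint[symmetric]) (auto simp: ivl_disj_un)
    also have "(\<Sum>x\<le>b. h x) = (\<Sum>j<b. h j) + h b" by (simp add: lessThan_Suc_atMost[symmetric])
    finally show ?thesis by simp
  qed
  finally have "(2::real) ^ (2 * (\<Sum>x\<le>L. h x)) < 2 ^ (L + 2)"
    by (simp add: power_mult power_add mult.commute)
  then show ?thesis by (rule power_less_imp_less_exp[rotated]) simp
qed

section \<open>Exactly two branch vertices\<close>

text \<open>Just after \<open>a\<close> the parameter is \<open>4 / (2 * P - 3)\<close>, and it
  doubles only \<open>b - a - 1\<close> times before \<open>b\<close>. To the right of
  \<open>b\<close> the bare stretch acts as an arm at least as long as the one hanging there.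
  Positivity at \<open>b\<close> then becomes the product inequality.\<close>

lemma two_branch_gap:
  assumes pos: "spine_pos_def L h"
    and a: "\<And>j. j < a \<Longrightarrow> h j = 0" "0 < h a" "h a \<le> a"
    and b: "\<And>j. b < j \<Longrightarrow> j \<le> L \<Longrightarrow> h j = 0" "0 < h b" "h b \<le> L - b"
    and ab: "a < b" "\<And>j. a < j \<Longrightarrow> j < b \<Longrightarrow> h j = 0"
  shows "(2 * 2 ^ h a - 3) * (2 * 2 ^ h b - 3) < (4::real) * 2 ^ (b - a)"
proof -
  let ?h = "\<lambda>x. h (L - x)"
  have bL: "b < L" using b by linarith
  define P Q D :: real where "P = 2 ^ h a" and "Q = 2 ^ h b" and "D = 4 / (2 * P - 3)"
  have "P \<ge> 2 ^ 1" "Q \<ge> 2 ^ 1" unfolding P_def Q_def using a b by (intro power_increasing; auto)+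
  then have PQ: "P \<ge> 2" "Q \<ge> 2" by simp_all
  have D: "D > 0" using PQ by (simp add: D_def)
  define k where "k = b - Suc a"
  have k: "b = Suc a + k" using ab by (simp add: k_def)
  have "spine_excess h (Suc a) \<le> - 1 / (1 + D)"
    unfolding D_def P_def using ab bL by (intro spine_excess_after_first_branch[OF pos _ a]) auto
  then have "spine_excess h b \<le> - 1 / (1 + 2 ^ k * D)"
    unfolding k using ab bL k by (intro spine_excess_along_path[OF pos D]) auto
  moreover have "spine_excess ?h (L - b) = arm_excess (L - b)"
    using b by (intro spine_excess_before_branch) auto
  moreover have "Q \<le> 2 ^ (L - b)" unfolding Q_def using b by (intro power_increasing) auto
  then have "arm_excess (L - b) \<le> 1 / (2 * Q - 1)" using PQ by (simp add: arm_excess_def frac_le)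
  moreover have "arm_excess (h b) = 1 / (2 * Q - 1)" by (simp add: arm_excess_def Q_def)
  ultimately have "1 / (1 + 2 ^ k * D) < 2 / (2 * Q - 1)"
    using spine_excess_sum_pos[OF pos, of b] bL by simp
  then have "2 * Q - 3 < 2 * (2 ^ k * D)" using D PQ by (simp add: field_simps add_pos_pos)
  also have "\<dots> = 4 * 2 ^ (b - a) / (2 * P - 3)" by (simp add: D_def k)
  finally show ?thesis using PQ by (simp add: P_def Q_def field_simps)
qed

text \<open>For an arm of length at least \<open>2\<close> the factor \<open>2 * P - 3\<close> is at
  least \<open>P\<close>, so exponents can be compared. If both arms are that long,
  \<open>h a + h b \<le> b - a + 1\<close>, and adding \<open>h a \<le> a\<close> and
  \<open>h b \<le> L - b\<close> gives a strict bound. If \<open>h a = 1 < h b\<close>, equality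
  needs \<open>a = 1\<close> and tightness of both \<open>h b \<le> b - a + 1\<close> and
  \<open>h b \<le> L - b\<close>.\<close>

lemma two_branch_bound:
  assumes pos: "spine_pos_def L h"
    and a: "\<And>j. j < a \<Longrightarrow> h j = 0" "0 < h a" "h a \<le> a"
    and b: "\<And>j. b < j \<Longrightarrow> j \<le> L \<Longrightarrow> h j = 0" "0 < h b" "h b \<le> L - b"
    and ab: "a < b" "\<And>j. a < j \<Longrightarrow> j < b \<Longrightarrow> h j = 0"
    and le: "h a \<le> h b"
  shows "2 * (h a + h b) \<le> L + 2"
    and "2 * (h a + h b) = L + 2 \<Longrightarrow> a = 1 \<and> h a = 1 \<and> b = h b \<and> 2 \<le> b \<and> L = 2 * b"
proof -
  have bL: "b < L" using b by linarith
  have half: "(2::real) ^ m \<ge> 4" if "m \<ge> 2" for m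
    using power_increasing[of 2 m "2::real"] that by simp
  have "2 * (h a + h b) \<le> L + 2 \<and>
    (2 * (h a + h b) = L + 2 \<longrightarrow> a = 1 \<and> h a = 1 \<and> b = h b \<and> 2 \<le> b \<and> L = 2 * b)"
  proof (cases "h b = 1")
    \<comment> \<open>Both arms have length \<open>1\<close>, while \<open>L \<ge> 3\<close>, so the
      bound is strict.\<close>
    case True
    then show ?thesis using a ab bL le by auto
  next
    case False
    then have Q: "(2::real) ^ h b \<ge> 4" using b by (intro half) simp
    have gap: "(2 * 2 ^ h a - 3) * (2 * 2 ^ h b - 3) < (2::real) ^ (b - a + 2)"
      using two_branch_gap[OF pos a b ab] by (simp add: power_add)
    show ?thesis
    proof (cases "h a = 1")
      case True
      have "(2::real) ^ h b \<le> 2 * 2 ^ h b - 3" using Q by simp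
      also have "\<dots> < 2 ^ (b - a + 2)" using gap True by simp
      finally have "h b < b - a + 2" by (rule power_less_imp_less_exp[rotated]) simp
      then show ?thesis using a b ab bL True False by auto
    next
      case False
      have P: "(2::real) ^ h a \<ge> 4" using a False by (intro half) simp
      have "(2::real) ^ (h a + h b) = 2 ^ h a * 2 ^ h b" by (rule power_add)
      also have "\<dots> \<le> (2 * 2 ^ h a - 3) * (2 * 2 ^ h b - 3)" using P Q by (intro mult_mono) auto
      also have "\<dots> < 2 ^ (b - a + 2)" by (rule gap)
      finally have "h a + h b < b - a + 2" by (rule power_less_imp_less_exp[rotated]) simp
      then show ?thesis using a b ab bL by auto
    qed
  qed
  then show "2 * (h a + h b) \<le> L + 2"
    and "2 * (h a + h b) = L + 2 \<Longrightarrow> a = 1 \<and> h a = 1 \<and> b = h b \<and> 2 \<le> b \<and> L = 2 * b"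
    by blast+
qed

section \<open>The extremal arms and the count over all cases\<close>

text \<open>For \<open>2 \<le> m\<close> these are the arms of
  \<open>quipu [1, m - 2, m] [1, m]\<close> over its horizontal path of length
  \<open>2 * m\<close>.\<close>

definition extremal_arms :: "nat \<Rightarrow> nat \<Rightarrow> nat" where
  "extremal_arms m x = (if x = 1 then 1 else if x = m then m else 0)"

lemma two_branch_extremal:
  assumes "a = 1 \<and> h a = 1 \<and> b = h b \<and> 2 \<le> b \<and> L = 2 * b"
    and "\<And>j. j \<le> L \<Longrightarrow> j \<noteq> a \<Longrightarrow> j \<noteq> b \<Longrightarrow> h j = 0"
  shows "\<exists>m\<ge>2. L = 2 * m \<and> (\<forall>x\<le>L. h x = extremal_arms m x)"
  using assms by (intro exI[of _ b]) (auto simp: extremal_arms_def)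

text \<open>The hypotheses \<open>fst\<close> and \<open>lst\<close> keep the first and the last arm
  no longer than the spine beyond its foot. The bound is strict unless there are exactly two branch
  vertices; the final disjunction records in which direction the spine is read.\<close>

theorem arms_bound:
  assumes pos: "spine_pos_def L h" and ends: "h 0 = 0" "h L = 0"
    and fst: "\<And>x. x \<le> L \<Longrightarrow> (\<And>j. j < x \<Longrightarrow> h j = 0) \<Longrightarrow> h x \<le> x"
    and lst: "\<And>x. x \<le> L \<Longrightarrow> (\<And>j. x < j \<Longrightarrow> j \<le> L \<Longrightarrow> h j = 0) \<Longrightarrow> h x \<le> L - x"
  shows "2 * (\<Sum>x\<le>L. h x) \<le> L + 2 \<and> (2 * (\<Sum>x\<le>L. h x) = L + 2 \<longrightarrow>
    (\<exists>m\<ge>2. L = 2 * m \<and> ((\<forall>x\<le>L. h x = extremal_arms m x) \<or> (\<forall>x\<le>L. h (L - x) = extremal_arms m x))))"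
proof -
  define B where "B = {x. x \<le> L \<and> 0 < h x}"
  have fin: "finite B" unfolding B_def by simp
  show ?thesis
  proof (cases "B = {}")
    case True
    then show ?thesis by (auto simp: B_def)
  next
    case False
    define a c where "a = Min B" and "c = Max B"
    have "a \<in> B" "c \<in> B" using fin False by (auto simp: a_def c_def)
    then have ac: "a \<le> L" "0 < h a" "c \<le> L" "0 < h c" by (auto simp: B_def)
    have range: "a \<le> j \<and> j \<le> c" if "j \<le> L" "h j \<noteq> 0" for j
      using that fin by (auto simp: a_def c_def B_def)
    have a0: "h j = 0" if "j < a" for j using that range[of j] ac by auto
    have c0: "h j = 0" if "c < j" "j \<le> L" for j using that range[of j] by auto
    have ha: "h a \<le> a" using fst[of a] ac a0 by auto
    have hc: "h c \<le> L - c" using lst[of c] ac c0 by auto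
    have "a \<le> c" using range[of a] ac by simp
    then consider "a = c" | b where "a < b" "b < c" "0 < h b" | "a < c" "\<And>b. a < b \<Longrightarrow> b < c \<Longrightarrow> h b = 0"
      by (metis gr0I le_neq_implies_less)
    then show ?thesis
    proof cases
      case 1
      have "(\<Sum>x\<le>L. h x) = (\<Sum>x\<in>{a}. h x)"
        using range ac 1 by (intro sum.mono_neutral_right) force+
      then show ?thesis using ha hc 1 ac by auto
    next
      case 2
      show ?thesis using middle_branch_bound[OF pos a0 ac(2) ha c0 ac(4) hc 2] by simp
    next
      case 3
      have off: "h j = 0" if "j \<le> L" "j \<noteq> a" "j \<noteq> c" for j
        using that range[of j] 3(2)[of j] by (cases "h j = 0") auto
      have sum: "(\<Sum>x\<le>L. h x) = h a + h c"
      proof -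
        have "(\<Sum>x\<le>L. h x) = (\<Sum>x\<in>{a,c}. h x)"
          using off ac by (intro sum.mono_neutral_right) auto
        then show ?thesis using 3 by simp
      qed
      show ?thesis
      proof (cases "h a \<le> h c")
        case True
        note tb = two_branch_bound[OF pos a0 ac(2) ha c0 ac(4) hc 3 True]
        show ?thesis unfolding sum
          using tb two_branch_extremal[of a h c L] off by blast
      next
        \<comment> \<open>The two-branch bound expects the shorter arm first, so the spine is read
          from its other end.\<close>
        case False
        let ?h = "\<lambda>x. h (L - x)"
        have "2 * (?h (L - c) + ?h (L - a)) \<le> L + 2 \<and> (2 * (?h (L - c) + ?h (L - a)) = L + 2 \<longrightarrow>
          L - c = 1 \<and> ?h (L - c) = 1 \<and> L - a = ?h (L - a) \<and> 2 \<le> L - a \<and> L = 2 * (L - a))"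
          using two_branch_bound[OF spine_pos_def_reflect[OF pos], of "L - c" "L - a"]
            a0 c0 ac ha hc 3 False by auto
        then have tb: "2 * (h a + h c) \<le> L + 2"
          "2 * (h a + h c) = L + 2 \<Longrightarrow>
            L - c = 1 \<and> ?h (L - c) = 1 \<and> L - a = ?h (L - a) \<and> 2 \<le> L - a \<and> L = 2 * (L - a)"
          unfolding diff_diff_cancel[OF ac(1)] diff_diff_cancel[OF ac(3)] by (simp_all add: add.commute)
        have off': "?h j = 0" if "j \<le> L" "j \<noteq> L - c" "j \<noteq> L - a" for j
          using off[of "L - j"] that by auto
        show ?thesis unfolding sum
          using tb two_branch_extremal[of "L - c" ?h "L - a" L] off' by blast
      qed
    qed
  qed
qed

section \<open>Open quipus as combs\<close>

text \<open>Listing vertices instead of arcs makes prolonging a path and mapping it under an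
  embedding plain list operations; \<open>zip vs (tl vs)\<close> recovers the arcs.\<close>

definition vertex_path :: "'a pair_pre_digraph \<Rightarrow> 'a list \<Rightarrow> bool" where
  "vertex_path G vs \<longleftrightarrow> vs \<noteq> [] \<and> distinct vs \<and> set vs \<subseteq> pverts G \<and> successively (\<lambda>u v. (u, v) \<in> parcs G) vs"

lemma zip_tl_walk:
  "vs \<noteq> [] \<Longrightarrow> pcas (hd vs) (zip vs (tl vs)) (last vs) \<and> pawalk_verts (hd vs) (zip vs (tl vs)) = vs"
proof (induction vs)
  case (Cons v vs)
  then show ?case by (cases vs) auto
qed simp

lemma set_zip_tl_subset:
  "successively (\<lambda>u v. (u, v) \<in> R) vs \<Longrightarrow> set (zip vs (tl vs)) \<subseteq> R"
proof (induction vs)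
  case (Cons v vs)
  then show ?case by (cases vs) auto
qed simp

lemma awalk_verts_successively:
  "pcas u p w \<Longrightarrow> set p \<subseteq> R \<Longrightarrow> successively (\<lambda>u v. (u, v) \<in> R) (pawalk_verts u p)"
proof (induction p arbitrary: u)
  case (Cons e p)
  then show ?case by (cases p) auto
qed simp

lemma tree_no_closing_arc:
  assumes "pair_graph G" "undirected_tree G" "vertex_path G vs" "3 \<le> length vs"
  shows "(last vs, hd vs) \<notin> parcs G"
proof
  assume arc: "(last vs, hd vs) \<in> parcs G"
  interpret pair_graph G by fact
  \<comment> \<open>The closing arc comes first, so that the tail of the visited vertices, which
    \<open>cycle\<close> requires to be distinct, is exactly \<open>vs\<close>.\<close>
  let ?p = "(last vs, hd vs) # zip vs (tl vs)"
  have vs: "vs \<noteq> []" "distinct vs" "last vs \<in> pverts G"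
    using assms by (auto simp: vertex_path_def)
  have "awalk (last vs) ?p (last vs)"
    unfolding awalk_def using zip_tl_walk[OF vs(1)] set_zip_tl_subset[of "parcs G" vs] assms(3) arc vs
    by (auto simp: vertex_path_def)
  moreover have "tl (pawalk_verts (last vs) ?p) = vs" using zip_tl_walk[OF vs(1)] by simp
  ultimately have "cycle ?p" unfolding cycle_def using vs by (auto intro!: exI[of _ "last vs"])
  moreover have "3 \<le> length ?p" using assms by simp
  ultimately show False using assms(2) unfolding undirected_tree_def by blast
qed

text \<open>A walk from a vertex of \<open>S\<close> to one outside must leave \<open>S\<close>
  along some arc; symmetry of the arcs turns connectedness into reachability in \<open>G\<close>
  itself.\<close>

lemma connected_boundary_arc:
  assumes "pair_graph G" "Digraph_Component.connected (with_proj G)" "S \<subseteq> pverts G" "S \<noteq> {}" "S \<noteq> pverts G"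
  shows "\<exists>v\<in>S. \<exists>w\<in>pverts G - S. (v, w) \<in> parcs G"
proof -
  interpret pair_graph G by fact
  obtain s t where s: "s \<in> S" "t \<in> pverts G" "t \<notin> S" using assms by blast
  have "s \<rightarrow>\<^sup>*\<^bsub>mk_symmetric G\<^esub> t"
    using assms s unfolding connected_def strongly_connected_def by auto
  then have "s \<rightarrow>\<^sup>*\<^bsub>G\<^esub> t" by (simp only: reachable_mk_symmetric_eq[OF pair_sym_arcs])
  then have "t \<in> S \<or> ?thesis"
  proof (induction rule: reachable_induct)
    case base
    then show ?case using s by blast
  next
    case (step x y)
    then show ?case using in_arcsD2[of x y] by auto
  qed
  then show ?thesis using s by blast
qed

lemma graph_degree_eq_card_neighbours:
  "graph_degree G v = card {w. (v, w) \<in> parcs G}"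
  unfolding graph_degree_def out_degree_def out_arcs_def
  by (rule bij_betw_same_card[of snd]) (auto simp: bij_betw_def inj_on_def image_iff)

lemma card_le_graph_degree:
  assumes "pair_graph G" "\<And>w. w \<in> W \<Longrightarrow> (v, w) \<in> parcs G"
  shows "card W \<le> graph_degree G v"
proof -
  interpret pair_graph G by fact
  have "{w. (v, w) \<in> parcs G} \<subseteq> pverts G" using in_arcsD2 by auto
  then have "finite {w. (v, w) \<in> parcs G}" using pair_finite_verts finite_subset by blast
  then show ?thesis unfolding graph_degree_eq_card_neighbours using assms by (intro card_mono) auto
qed

section \<open>Combs in the grid and their embeddings\<close>

definition comb_verts :: "nat \<Rightarrow> (nat \<Rightarrow> nat) \<Rightarrow> (nat \<times> nat) set" where
  "comb_verts L h = {(x, y). x \<le> L \<and> y \<le> h x}"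

text \<open>Adjacency is preserved in one direction only, so that embeddings can be enlarged vertex
  by vertex; in a tree the converse follows from acyclicity.\<close>

definition comb_embedding :: "'a pair_pre_digraph \<Rightarrow> nat \<Rightarrow> (nat \<Rightarrow> nat) \<Rightarrow> (nat \<times> nat \<Rightarrow> 'a) \<Rightarrow> bool" where
  "comb_embedding G L h f \<longleftrightarrow> inj_on f (comb_verts L h) \<and> f ` comb_verts L h \<subseteq> pverts G \<and>
     (\<forall>a\<in>comb_verts L h. \<forall>b\<in>comb_verts L h. quipu_adj a b \<longrightarrow> (f a, f b) \<in> parcs G)"

definition comb_iso :: "'a pair_pre_digraph \<Rightarrow> nat \<Rightarrow> (nat \<Rightarrow> nat) \<Rightarrow> (nat \<times> nat \<Rightarrow> 'a) \<Rightarrow> bool" where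
  "comb_iso G L h f \<longleftrightarrow> bij_betw f (comb_verts L h) (pverts G) \<and>
     (\<forall>a\<in>comb_verts L h. \<forall>b\<in>comb_verts L h. (f a, f b) \<in> parcs G \<longleftrightarrow> quipu_adj a b)"

lemma comb_verts_eq_Sigma: "comb_verts L h = Sigma {..L} (\<lambda>x. {..h x})"
  by (auto simp: comb_verts_def)

lemma finite_comb_verts [simp]: "finite (comb_verts L h)"
  by (simp add: comb_verts_eq_Sigma)

lemma card_comb_verts: "card (comb_verts L h) = L + 1 + (\<Sum>x\<le>L. h x)"
  by (simp add: comb_verts_eq_Sigma sum_Suc)

lemma quipu_adj_sym: "quipu_adj a b \<longleftrightarrow> quipu_adj b a"
  by (auto simp: quipu_adj_def)

lemma simple_path_of_rtrancl:
  assumes "(a, b) \<in> R\<^sup>*"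
  shows "\<exists>vs. vs \<noteq> [] \<and> hd vs = a \<and> last vs = b \<and> distinct vs \<and> successively (\<lambda>u v. (u, v) \<in> R) vs"
  using assms
proof (induction rule: rtrancl_induct)
  case base
  show ?case by (intro exI[of _ "[a]"]) simp
next
  case (step b c)
  then obtain vs where vs: "vs \<noteq> []" "hd vs = a" "last vs = b" "distinct vs" "successively (\<lambda>u v. (u, v) \<in> R) vs"
    by blast
  show ?case
  proof (cases "c \<in> set vs")
    case True
    then obtain us ws where us: "vs = us @ c # ws" by (meson split_list)
    show ?thesis
      using vs us by (intro exI[of _ "us @ [c]"]) (auto simp: successively_append_iff successively_Cons hd_append)
  next
    case False
    then show ?thesis
      using vs step by (intro exI[of _ "vs @ [c]"]) (auto simp: successively_append_iff)
  qed
qed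

lemma comb_connected:
  assumes "a \<in> comb_verts L h" "b \<in> comb_verts L h"
  shows "(a, b) \<in> {(c, d). c \<in> comb_verts L h \<and> d \<in> comb_verts L h \<and> quipu_adj c d}\<^sup>*"
proof -
  let ?R = "{(c, d). c \<in> comb_verts L h \<and> d \<in> comb_verts L h \<and> quipu_adj c d}"
  have sym: "sym ?R" by (auto simp: sym_def quipu_adj_sym)
  have spine: "((0, 0), (x, 0)) \<in> ?R\<^sup>*" if "x \<le> L" for x
    using that
  proof (induction x)
    case (Suc x)
    then have "((x, 0), (Suc x, 0)) \<in> ?R" by (auto simp: comb_verts_def quipu_adj_def)
    with Suc show ?case by (meson Suc_leD rtrancl.rtrancl_into_rtrancl)
  qed simp
  have all: "((0, 0), (x, y)) \<in> ?R\<^sup>*" if "x \<le> L" "y \<le> h x" for x y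
    using that(2)
  proof (induction y)
    case 0
    then show ?case using spine that by simp
  next
    case (Suc y)
    then have "((x, y), (x, Suc y)) \<in> ?R" using that by (auto simp: comb_verts_def quipu_adj_def)
    with Suc show ?case by (meson Suc_leD rtrancl.rtrancl_into_rtrancl)
  qed
  have "((0, 0), a) \<in> ?R\<^sup>*" "((0, 0), b) \<in> ?R\<^sup>*"
    using assms all by (auto simp: comb_verts_def)
  then show ?thesis using sym by (meson rtrancl_trans symD sym_rtrancl)
qed

text \<open>An arc between the images of nonadjacent comb points would close the image of a simple
  comb path between them to a cycle of length at least \<open>3\<close>.\<close>

lemma comb_embedding_reflects_adj:
  assumes G: "pair_graph G" and tree: "undirected_tree G" and emb: "comb_embedding G L h f"
    and a: "a \<in> comb_verts L h" and b: "b \<in> comb_verts L h" and arc: "(f a, f b) \<in> parcs G"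
  shows "quipu_adj a b"
proof (rule ccontr)
  interpret pair_graph G by (rule G)
  assume nadj: "\<not> quipu_adj a b"
  let ?R = "{(c, d). c \<in> comb_verts L h \<and> d \<in> comb_verts L h \<and> quipu_adj c d}"
  obtain cs where cs: "cs \<noteq> []" "hd cs = a" "last cs = b" "distinct cs" "successively (\<lambda>u v. (u, v) \<in> ?R) cs"
    using simple_path_of_rtrancl[OF comb_connected[OF a b]] by blast
  have "a \<noteq> b" using arc no_loops' by blast
  have len: "3 \<le> length cs"
  proof (rule ccontr)
    assume "\<not> ?thesis"
    moreover have "length cs \<noteq> 0" using cs(1) by simp
    ultimately consider "length cs = 1" | "length cs = 2" by linarith
    then show False
    proof cases
      case 1
      then obtain c where "cs = [c]" by (auto simp: length_Suc_conv)
      then show False using cs \<open>a \<noteq> b\<close> by auto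
    next
      case 2
      then obtain c d where "cs = [c, d]" by (auto simp: length_Suc_conv numeral_2_eq_2)
      then show False using cs nadj by auto
    qed
  qed
  have sub: "set cs \<subseteq> comb_verts L h"
  proof
    fix c assume "c \<in> set cs"
    then obtain i where i: "i < length cs" "cs ! i = c" by (auto simp: in_set_conv_nth)
    show "c \<in> comb_verts L h"
    proof (cases "Suc i < length cs")
      case True
      then show ?thesis using successively_nth[OF cs(5), of i] i by auto
    next
      case False
      then have "c = last cs" using i cs(1) by (metis Suc_lessI diff_Suc_1 last_conv_nth)
      then show ?thesis using cs b by simp
    qed
  qed
  have "vertex_path G (map f cs)"
    unfolding vertex_path_def
  proof (intro conjI)
    show "distinct (map f cs)" using cs sub emb by (auto simp: distinct_map comb_embedding_def intro: inj_on_subset)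
    show "set (map f cs) \<subseteq> pverts G" using sub emb by (auto simp: comb_embedding_def)
    show "successively (\<lambda>u v. (u, v) \<in> parcs G) (map f cs)"
      unfolding successively_map using cs(5)
      by (rule successively_mono) (use emb in \<open>auto simp: comb_embedding_def\<close>)
  qed (use cs in auto)
  then have "(last (map f cs), hd (map f cs)) \<notin> parcs G"
    using len by (intro tree_no_closing_arc[OF G tree]) auto
  then have "(f b, f a) \<notin> parcs G" using cs by (simp add: hd_map last_map)
  then show False using arc arcs_symmetric by blast
qed

lemma comb_embedding_extend:
  assumes "comb_embedding G L h f" "pair_graph G" "x \<le> L" "(f (x, h x), w) \<in> parcs G" "w \<notin> f ` comb_verts L h"
  shows "comb_embedding G L (h(x := Suc (h x))) (f((x, Suc (h x)) := w))"
proof -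
  interpret pair_graph G by fact
  let ?h = "h(x := Suc (h x))" and ?f = "f((x, Suc (h x)) := w)" and ?n = "(x, Suc (h x))"
  have V: "comb_verts L ?h = insert ?n (comb_verts L h)" using assms(3) by (auto simp: comb_verts_def split: if_splits)
  have new: "?n \<notin> comb_verts L h" by (simp add: comb_verts_def)
  have f: "?f c = f c" if "c \<in> comb_verts L h" for c using that new by auto
  \<comment> \<open>The new point lies above row \<open>0\<close>, where all neighbours are
    vertical, and the comb has nothing above it: the old tip is its only neighbour.\<close>
  have nb: "c = (x, h x)" if "c \<in> comb_verts L h" "quipu_adj ?n c" for c
    using that by (auto simp: comb_verts_def quipu_adj_def)
  have arc: "(w, f (x, h x)) \<in> parcs G" using assms(4) arcs_symmetric by blast
  have loop: "\<not> quipu_adj ?n ?n" by (simp add: quipu_adj_def)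
  show ?thesis
    unfolding comb_embedding_def V
  proof (intro conjI ballI impI)
    have "inj_on ?f (comb_verts L h)"
      using assms(1) f unfolding comb_embedding_def by (metis inj_on_cong)
    moreover have "?f ` comb_verts L h = f ` comb_verts L h" using f by (intro image_cong) auto
    ultimately show "inj_on ?f (insert ?n (comb_verts L h))"
      using assms(5) new by simp
    show "?f ` insert ?n (comb_verts L h) \<subseteq> pverts G"
      using assms in_arcsD2[OF assms(4)] f by (auto simp: comb_embedding_def)
  next
    fix a b
    assume a: "a \<in> insert ?n (comb_verts L h)" and b: "b \<in> insert ?n (comb_verts L h)" and ab: "quipu_adj a b"
    consider "a = ?n" "b = ?n" | "a = ?n" "b \<in> comb_verts L h" | "a \<in> comb_verts L h" "b = ?n"
      | "a \<in> comb_verts L h" "b \<in> comb_verts L h" using a b by blast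
    then show "(?f a, ?f b) \<in> parcs G"
    proof cases
      case 1
      then show ?thesis using ab loop by simp
    next
      case 2
      then have "b = (x, h x)" using nb ab by blast
      then show ?thesis using 2 arc by simp
    next
      case 3
      then have "a = (x, h x)" using nb ab quipu_adj_sym by blast
      then show ?thesis using 3 assms(4) by simp
    next
      case 4
      then have "(f a, f b) \<in> parcs G" using assms(1) ab by (simp add: comb_embedding_def)
      then show ?thesis using f[OF 4(1)] f[OF 4(2)] by simp
    qed
  qed
qed

text \<open>Two extremal choices are nested: a longest path through all vertices of degree 3 as
  spine, then a comb over it with the largest total arm length. Together they make the comb exhaust
  the tree; maximality of the spine also bounds the first and the last arm.\<close>

theorem open_quipu_comb:
  assumes G: "pair_graph G" and quipu: "open_quipu G"
  obtains L h f where "comb_iso G L h f" "h 0 = 0" "h L = 0"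
    "\<And>x. x \<le> L \<Longrightarrow> (\<And>j. j < x \<Longrightarrow> h j = 0) \<Longrightarrow> h x \<le> x"
    "\<And>x. x \<le> L \<Longrightarrow> (\<And>j. x < j \<Longrightarrow> j \<le> L \<Longrightarrow> h j = 0) \<Longrightarrow> h x \<le> L - x"
proof -
  interpret pair_graph G by (rule G)
  let ?D3 = "{v \<in> pverts G. graph_degree G v = 3}"
  have tree: "undirected_tree G" and deg: "\<And>v. v \<in> pverts G \<Longrightarrow> graph_degree G v \<le> 3"
    using quipu by (auto simp: open_quipu_def)
  have conn: "Digraph_Component.connected (with_proj G)" using tree by (simp add: undirected_tree_def)
  define spine where "spine vs \<longleftrightarrow> vertex_path G vs \<and> ?D3 \<subseteq> set vs" for vs
  have spine_len: "length vs \<le> card (pverts G)" if "spine vs" for vs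
    using that card_mono[OF pair_finite_verts, of "set vs"] by (simp add: spine_def vertex_path_def distinct_card)
  obtain u p w where p: "apath u p w" "?D3 \<subseteq> set (pawalk_verts u p)"
    using quipu unfolding open_quipu_def by auto
  have "spine (pawalk_verts u p)"
    using p awalk_verts_successively[of u p w "parcs G"] awalk_verts_non_Nil[of u p]
    by (auto simp: spine_def vertex_path_def apath_def awalk_def dest: awalk_verts_in_verts[rotated])
  moreover have "\<forall>vs. spine vs \<longrightarrow> length vs < Suc (card (pverts G))"
    using spine_len by (simp add: less_Suc_eq_le)
  ultimately have "\<exists>vs. spine vs \<and> (\<forall>ws. spine ws \<longrightarrow> length ws \<le> length vs)"
    by (rule ex_has_greatest_nat)
  then obtain vs where vs: "spine vs" "\<And>ws. spine ws \<Longrightarrow> length ws \<le> length vs" by blast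
  define L where "L = length vs - 1"
  have len: "length vs = Suc L" using vs(1) by (cases vs) (auto simp: L_def spine_def vertex_path_def)
  define good where "good hf \<longleftrightarrow> (case hf of (h, f) \<Rightarrow> comb_embedding G L h f \<and> h 0 = 0 \<and> h L = 0 \<and> (\<forall>x\<le>L. f (x, 0) = vs ! x))" for hf
  have "good (\<lambda>_. 0, \<lambda>(x, y). vs ! x)"
  proof -
    have "(vs ! x, vs ! Suc x) \<in> parcs G" if "x < L" for x
      using vs(1) that len successively_nth[of _ vs x] by (auto simp: spine_def vertex_path_def)
    then show ?thesis
      using vs(1) len arcs_symmetric
      by (auto simp: good_def comb_embedding_def comb_verts_def inj_on_def spine_def vertex_path_def
          nth_eq_iff_index_eq quipu_adj_def subset_iff)
  qed
  moreover have "\<forall>hf. good hf \<longrightarrow> (\<Sum>x\<le>L. fst hf x) < Suc (card (pverts G))"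
  proof (intro allI impI)
    fix hf assume "good hf"
    then obtain h f where hf: "hf = (h, f)" "comb_embedding G L h f" by (auto simp: good_def)
    then have "card (comb_verts L h) \<le> card (pverts G)"
      by (intro card_inj_on_le[of f]) (auto simp: comb_embedding_def)
    then show "(\<Sum>x\<le>L. fst hf x) < Suc (card (pverts G))" using hf by (simp add: card_comb_verts)
  qed
  ultimately have "\<exists>hf. good hf \<and> (\<forall>hf'. good hf' \<longrightarrow> (\<Sum>x\<le>L. fst hf' x) \<le> (\<Sum>x\<le>L. fst hf x))"
    by (rule ex_has_greatest_nat)
  then obtain hf where hf: "good hf" "\<And>hf'. good hf' \<Longrightarrow> (\<Sum>x\<le>L. fst hf' x) \<le> (\<Sum>x\<le>L. fst hf x)"
    by blast
  obtain h f where hf_eq: "hf = (h, f)" by (cases hf)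
  have emb: "comb_embedding G L h f" and h0: "h 0 = 0" and hL: "h L = 0" and fvs: "\<And>x. x \<le> L \<Longrightarrow> f (x, 0) = vs ! x"
    using hf(1) by (auto simp: good_def hf_eq)
  have hmax: "(\<Sum>x\<le>L. h' x) \<le> (\<Sum>x\<le>L. h x)" if "good (h', f')" for h' f'
    using hf(2)[OF that] by (simp add: hf_eq)
  let ?C = "comb_verts L h"
  have inj: "f a = f b \<longleftrightarrow> a = b" if "a \<in> ?C" "b \<in> ?C" for a b
    using emb that by (auto simp: comb_embedding_def inj_on_def)
  have adj: "(f a, f b) \<in> parcs G" if "a \<in> ?C" "b \<in> ?C" "quipu_adj a b" for a b
    using emb that by (auto simp: comb_embedding_def)
  have set_vs: "set vs = (\<lambda>x. f (x, 0)) ` {..L}"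
    using fvs len by (auto simp: set_conv_nth image_iff less_Suc_eq_le Bex_def)
  have surj: "f ` ?C = pverts G"
  proof (rule ccontr)
    assume ne: "f ` ?C \<noteq> pverts G"
    have "(0, 0) \<in> ?C" by (simp add: comb_verts_def)
    then have "f ` ?C \<noteq> {}" by blast
    then obtain v w where vw: "v \<in> f ` ?C" "w \<in> pverts G" "w \<notin> f ` ?C" "(v, w) \<in> parcs G"
      using connected_boundary_arc[OF G conn, of "f ` ?C"] emb ne by (auto simp: comb_embedding_def)
    then obtain x y where xy: "x \<le> L" "y \<le> h x" "v = f (x, y)" by (auto simp: comb_verts_def)
    have C: "(x, y) \<in> ?C" using xy by (simp add: comb_verts_def)
    have wvs: "w \<notin> set vs" using vw(3) unfolding set_vs by (auto simp: comb_verts_def)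
    have vp: "vertex_path G vs" "?D3 \<subseteq> set vs" using vs(1) by (auto simp: spine_def)
    have w': "(w, v) \<in> parcs G" using vw arcs_symmetric by blast
    \<comment> \<open>A vertex \<open>w\<close> attached outside the comb at \<open>(x, y)\<close>
      would prolong the spine at an end, prolong an arm at its tip, force a vertex of degree 3 off
      the spine, or force degree 4 on it.\<close>
    consider "x = 0" | "x = L" | "x \<noteq> 0" "x \<noteq> L" "y = h x" | "0 < x" "x < L" "0 < y" "y < h x" | "0 < x" "x < L" "y = 0" "0 < h x"
      using xy by linarith
    then show False
    proof cases
      case 1
      then have "v = hd vs" using xy h0 fvs[of 0] len by (simp add: hd_conv_nth vp(1)[unfolded vertex_path_def])
      then have "spine (w # vs)"
        using vp wvs w' vw(2) by (auto simp: spine_def vertex_path_def successively_Cons)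
      then show False using vs(2) by force
    next
      case 2
      then have "v = last vs" using xy hL fvs[of L] len by (simp add: last_conv_nth vp(1)[unfolded vertex_path_def])
      then have "spine (vs @ [w])"
        using vp wvs vw(2,4) by (auto simp: spine_def vertex_path_def successively_append_iff)
      then show False using vs(2) by force
    next
      case 3
      have "comb_embedding G L (h(x := Suc (h x))) (f((x, Suc (h x)) := w))"
        using 3 xy vw by (intro comb_embedding_extend[OF emb G]) auto
      then have "good (h(x := Suc (h x)), f((x, Suc (h x)) := w))"
        using 3 h0 hL fvs by (auto simp: good_def)
      then have "(\<Sum>z\<le>L. (h(x := Suc (h x))) z) \<le> (\<Sum>z\<le>L. h z)" by (rule hmax)
      moreover have "(\<Sum>z\<le>L. (h(x := Suc (h x))) z) = Suc (h x) + (\<Sum>z\<in>{..L}-{x}. h z)"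
        using xy(1) by (subst sum.remove[of _ x]) auto
      moreover have "(\<Sum>z\<le>L. h z) = h x + (\<Sum>z\<in>{..L}-{x}. h z)"
        using xy(1) by (subst sum.remove[of _ x]) auto
      ultimately show False by simp
    next
      case 4
      let ?a = "(x, y - 1)" and ?b = "(x, Suc y)"
      have ab: "?a \<in> ?C" "?b \<in> ?C" using 4 xy by (auto simp: comb_verts_def)
      have "card {f ?a, f ?b, w} \<le> graph_degree G v"
        using ab C adj vw(4) 4 unfolding xy by (intro card_le_graph_degree[OF G]) (auto simp: quipu_adj_def)
      moreover have "card {f ?a, f ?b, w} = 3" using ab vw(3) inj[OF ab] by (auto simp: card_insert_if)
      ultimately have "graph_degree G v = 3" using deg[of v] vw(4) in_arcsD1[of v w] by simp
      then have "v \<in> set vs" using vp in_arcsD1[OF vw(4)] by auto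
      then obtain x' where "x' \<le> L" "v = f (x', 0)" unfolding set_vs by auto
      then show False using inj[OF C, of "(x', 0)"] 4 xy by (auto simp: comb_verts_def)
    next
      case 5
      let ?a = "(x - 1, 0)" and ?b = "(Suc x, 0)" and ?c = "(x, Suc 0)"
      have ab: "?a \<in> ?C" "?b \<in> ?C" "?c \<in> ?C" using 5 xy by (auto simp: comb_verts_def)
      have "card {f ?a, f ?b, f ?c, w} \<le> graph_degree G v"
        using ab C adj vw(4) 5 unfolding xy by (intro card_le_graph_degree[OF G]) (auto simp: quipu_adj_def)
      moreover have "card {f ?a, f ?b, f ?c, w} = 4"
        using ab vw(3) inj[OF ab(1,2)] inj[OF ab(1,3)] inj[OF ab(2,3)] by (auto simp: card_insert_if)
      ultimately show False using deg[of v] vw(4) in_arcsD1[of v w] by simp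
    qed
  qed
  have iso: "comb_iso G L h f"
    using emb surj adj comb_embedding_reflects_adj[OF G tree emb]
    by (auto simp: comb_iso_def comb_embedding_def bij_betw_def)
  \<comment> \<open>Without an arm a spine vertex has at most two neighbours. Hence a path through
    the feet of all arms contains every vertex of degree 3.\<close>
  have no_arm: "f (x, 0) \<notin> ?D3" if "x \<le> L" "h x = 0" for x
  proof
    assume D3: "f (x, 0) \<in> ?D3"
    have C: "(x, 0) \<in> ?C" using that by (simp add: comb_verts_def)
    have "{w. (f (x, 0), w) \<in> parcs G} \<subseteq> {f (x - 1, 0), f (Suc x, 0)}"
    proof
      fix w assume "w \<in> {w. (f (x, 0), w) \<in> parcs G}"
      then have w: "(f (x, 0), w) \<in> parcs G" by simp
      then have "w \<in> f ` ?C" using in_arcsD2[OF w] surj by simp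
      then obtain c where c: "c \<in> ?C" "w = f c" by blast
      then have "quipu_adj (x, 0) c" using w iso C by (auto simp: comb_iso_def)
      then have "c = (x - 1, 0) \<or> c = (Suc x, 0)" using c(1) that by (cases c) (auto simp: quipu_adj_def comb_verts_def)
      then show "w \<in> {f (x - 1, 0), f (Suc x, 0)}" using c by auto
    qed
    then have "graph_degree G (f (x, 0)) \<le> card {f (x - 1, 0), f (Suc x, 0)}"
      unfolding graph_degree_eq_card_neighbours by (intro card_mono) auto
    also have "\<dots> \<le> 2" by (simp add: card_insert_if)
    finally show False using D3 by simp
  qed
  \<comment> \<open>Every comb path through the feet of all arms competes with the chosen spine, so
    it is no longer.\<close>
  have comb_spine: "length cs \<le> Suc L"
    if cs: "cs \<noteq> []" "distinct cs" "set cs \<subseteq> ?C" "successively quipu_adj cs"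
      and br: "\<And>x. x \<le> L \<Longrightarrow> h x \<noteq> 0 \<Longrightarrow> (x, 0) \<in> set cs" for cs
  proof -
    have "vertex_path G (map f cs)"
      unfolding vertex_path_def
    proof (intro conjI)
      show "distinct (map f cs)" using cs emb by (auto simp: distinct_map comb_embedding_def intro: inj_on_subset)
      show "set (map f cs) \<subseteq> pverts G" using cs emb by (auto simp: comb_embedding_def)
      show "successively (\<lambda>u v. (u, v) \<in> parcs G) (map f cs)"
        unfolding successively_map using cs(4)
        by (rule successively_mono) (use adj cs(3) in blast)
    qed (use cs in auto)
    moreover have "?D3 \<subseteq> set (map f cs)"
    proof
      fix v assume v: "v \<in> ?D3"
      then have "v \<in> set vs" using vs(1) by (auto simp: spine_def)
      then obtain x where x: "x \<le> L" "v = f (x, 0)" unfolding set_vs by auto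
      then have "h x \<noteq> 0" using v no_arm by auto
      then show "v \<in> set (map f cs)" using br x by auto
    qed
    ultimately have "spine (map f cs)" by (simp add: spine_def)
    then show ?thesis using vs(2) len by fastforce
  qed
  show thesis
  proof (rule that[OF iso h0 hL])
    fix x assume x: "x \<le> L" and z: "\<And>j. j < x \<Longrightarrow> h j = 0"
    \<comment> \<open>The competitor runs from the right end of the spine back to \<open>x\<close>
      and then up the arm. It misses no foot, as the arms before \<open>x\<close> are empty, and its
      \<open>L - x + 1 + h x\<close> vertices number at most \<open>L + 1\<close>.\<close>
    let ?cs = "map (\<lambda>i. (L - i, 0)) [0..<Suc (L - x)] @ map (\<lambda>i. (x, Suc i)) [0..<h x]"
    have "length ?cs \<le> Suc L"
    proof (rule comb_spine)
      show "distinct ?cs" by (auto simp: distinct_map inj_on_def simp del: upt_Suc)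
      show "set ?cs \<subseteq> ?C" using x by (auto simp: comb_verts_def simp del: upt_Suc)
      show "successively quipu_adj ?cs"
        unfolding successively_conv_nth
      proof (intro allI impI)
        fix i assume i: "Suc i < length ?cs"
        consider "Suc i \<le> L - x" | "i = L - x" | "L - x < i" by linarith
        then show "quipu_adj (?cs ! i) (?cs ! Suc i)"
          using i x by cases (auto simp: nth_append quipu_adj_def simp del: upt_Suc)
      qed
      show "(j, 0) \<in> set ?cs" if "j \<le> L" "h j \<noteq> 0" for j
      proof -
        have "x \<le> j" using that z[of j] by (cases "j < x") auto
        then have "L - j \<in> {0..<Suc (L - x)}" "(j, 0) = (L - (L - j), 0)" using that by auto
        then show ?thesis by (auto simp del: upt_Suc)
      qed
    qed simp
    then show "h x \<le> x" using x by simp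
  next
    fix x assume x: "x \<le> L" and z: "\<And>j. x < j \<Longrightarrow> j \<le> L \<Longrightarrow> h j = 0"
    let ?cs = "map (\<lambda>j. (j, 0)) [0..<Suc x] @ map (\<lambda>i. (x, Suc i)) [0..<h x]"
    have "length ?cs \<le> Suc L"
    proof (rule comb_spine)
      show "distinct ?cs" by (auto simp: distinct_map inj_on_def simp del: upt_Suc)
      show "set ?cs \<subseteq> ?C" using x by (auto simp: comb_verts_def simp del: upt_Suc)
      show "successively quipu_adj ?cs"
        unfolding successively_conv_nth
      proof (intro allI impI)
        fix i assume i: "Suc i < length ?cs"
        consider "Suc i \<le> x" | "i = x" | "x < i" by linarith
        then show "quipu_adj (?cs ! i) (?cs ! Suc i)"
          using i by cases (auto simp: nth_append quipu_adj_def simp del: upt_Suc)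
      qed
      show "(j, 0) \<in> set ?cs" if "j \<le> L" "h j \<noteq> 0" for j
        using that z[of j] by force
    qed simp
    then show "h x \<le> L - x" using x by simp
  qed
qed

section \<open>From the spectral radius to the spine\<close>

text \<open>The counterpart of \<open>spine_minimiser\<close> for one hanging path: \<open>p\<close>
  realises the elimination of the path down to its foot, where it equals \<open>1\<close>.\<close>

lemma arm_minimiser:
  "\<exists>p :: nat \<Rightarrow> real. p 0 = 1 \<and>
     3 / 2 * sqrt 2 * (\<Sum>y\<le>m. (p y)\<^sup>2) - 2 * (\<Sum>y<m. p y * p (Suc y)) = (2 + arm_excess m) / sqrt 2"
proof (induction m)
  case 0
  show ?case by (intro exI[of _ "\<lambda>_. 1"]) (simp add: field_simps)
next
  case (Suc m)
  then obtain p :: "nat \<Rightarrow> real" where p: "p 0 = 1"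
    "3 / 2 * sqrt 2 * (\<Sum>y\<le>m. (p y)\<^sup>2) - 2 * (\<Sum>y<m. p y * p (Suc y)) = (2 + arm_excess m) / sqrt 2"
    by blast
  define d where "d = 2 + arm_excess m"
  define c where "c = sqrt 2 / d"
  \<comment> \<open>The new foot takes index \<open>0\<close>; the old arm moves up by one and is
    scaled by the optimal factor.\<close>
  define p' where "p' y = (case y of 0 \<Rightarrow> 1 | Suc z \<Rightarrow> c * p z)" for y
  have d: "d > 0" using arm_excess_pos[of m] by (simp add: d_def)
  have 1: "(\<Sum>y\<le>Suc m. (p' y)\<^sup>2) = 1 + c\<^sup>2 * (\<Sum>y\<le>m. (p y)\<^sup>2)"
    by (simp add: sum.atMost_Suc_shift p'_def power_mult_distrib sum_distrib_left del: sum.atMost_Suc)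
  have 2: "(\<Sum>y<Suc m. p' y * p' (Suc y)) = c + c\<^sup>2 * (\<Sum>y<m. p y * p (Suc y))"
    by (simp add: sum.lessThan_Suc_shift p'_def p sum_distrib_left power2_eq_square mult_ac del: sum.lessThan_Suc)
  have "3 / 2 * sqrt 2 * (\<Sum>y\<le>Suc m. (p' y)\<^sup>2) - 2 * (\<Sum>y<Suc m. p' y * p' (Suc y))
    = 3 / 2 * sqrt 2 - 2 * c + c\<^sup>2 * (3 / 2 * sqrt 2 * (\<Sum>y\<le>m. (p y)\<^sup>2) - 2 * (\<Sum>y<m. p y * p (Suc y)))"
    unfolding 1 2 by (simp only: algebra_simps)
  also have "\<dots> = 3 / 2 * sqrt 2 - 2 * c + c\<^sup>2 * (d / sqrt 2)"
    unfolding p(2) d_def ..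
  also have "\<dots> = (3 - 2 / d) / sqrt 2"
    using d by (simp add: c_def power2_eq_square field_simps)
  also have "\<dots> = (2 + arm_excess (Suc m)) / sqrt 2"
    by (simp add: arm_excess_Suc d_def)
  finally show ?case by (intro exI[of _ p']) (simp add: p'_def)
qed

text \<open>Each edge is oriented away from \<open>(0, 0)\<close>, along the spine or up an arm; the
  remaining arcs are the swapped ones, whence the factor \<open>2\<close>.\<close>

lemma comb_arc_sum:
  fixes w :: "nat \<times> nat \<Rightarrow> real"
  shows "(\<Sum>(a, b)\<in>{(a, b). a \<in> comb_verts L h \<and> b \<in> comb_verts L h \<and> quipu_adj a b}. w a * w b)
    = 2 * (\<Sum>x<L. w (x, 0) * w (Suc x, 0)) + 2 * (\<Sum>x\<le>L. \<Sum>y<h x. w (x, y) * w (x, Suc y))"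
proof -
  let ?H = "(\<lambda>x. ((x, 0::nat), (Suc x, 0::nat))) ` {..<L}"
  let ?U = "(\<lambda>(x, y). ((x, y), (x, Suc y))) ` Sigma {..L} (\<lambda>x. {..<h x})"
  let ?E = "?H \<union> ?U"
  let ?g = "\<lambda>(a, b). w a * w b"
  have arcs: "{(a, b). a \<in> comb_verts L h \<and> b \<in> comb_verts L h \<and> quipu_adj a b} = ?E \<union> prod.swap ` ?E"
  proof (intro equalityI subsetI)
    fix ab assume "ab \<in> {(a, b). a \<in> comb_verts L h \<and> b \<in> comb_verts L h \<and> quipu_adj a b}"
    then show "ab \<in> ?E \<union> prod.swap ` ?E"
      by (auto simp: comb_verts_def quipu_adj_def image_iff Bex_def Suc_le_eq)
  next
    fix ab assume "ab \<in> ?E \<union> prod.swap ` ?E"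
    then show "ab \<in> {(a, b). a \<in> comb_verts L h \<and> b \<in> comb_verts L h \<and> quipu_adj a b}"
      by (auto simp: comb_verts_def quipu_adj_def)
  qed
  have fin: "finite ?E" by simp
  have "?E \<inter> prod.swap ` ?E = {}" by auto
  then have "sum ?g (?E \<union> prod.swap ` ?E) = sum ?g ?E + sum ?g (prod.swap ` ?E)"
    using fin by (intro sum.union_disjoint) auto
  also have "sum ?g (prod.swap ` ?E) = sum ?g ?E"
    by (subst sum.reindex) (auto simp: case_prod_beta mult.commute intro!: sum.cong)
  also have "sum ?g ?E = sum ?g ?H + sum ?g ?U"
    by (intro sum.union_disjoint) auto
  also have "sum ?g ?H = (\<Sum>x<L. w (x, 0) * w (Suc x, 0))"
    by (subst sum.reindex) (auto simp: inj_on_def)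
  also have "sum ?g ?U = (\<Sum>(x, y)\<in>Sigma {..L} (\<lambda>x. {..<h x}). w (x, y) * w (x, Suc y))"
    by (subst sum.reindex) (auto simp: inj_on_def case_prod_beta)
  also have "\<dots> = (\<Sum>x\<le>L. \<Sum>y<h x. w (x, y) * w (x, Suc y))"
    by (simp add: sum.Sigma)
  finally show ?thesis unfolding arcs by simp
qed

lemma comb_iso_arc_bij:
  assumes "pair_graph G" "comb_iso G L h f"
  shows "bij_betw (map_prod f f) {(a, b). a \<in> comb_verts L h \<and> b \<in> comb_verts L h \<and> quipu_adj a b} (parcs G)"
proof -
  interpret pair_graph G by fact
  have inj: "inj_on f (comb_verts L h)" and surj: "f ` comb_verts L h = pverts G"
    using assms(2) by (auto simp: comb_iso_def bij_betw_def)
  show ?thesis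
    unfolding bij_betw_def
  proof
    show "inj_on (map_prod f f) {(a, b). a \<in> comb_verts L h \<and> b \<in> comb_verts L h \<and> quipu_adj a b}"
      using inj by (auto simp: inj_on_def)
    show "map_prod f f ` {(a, b). a \<in> comb_verts L h \<and> b \<in> comb_verts L h \<and> quipu_adj a b} = parcs G"
    proof (intro equalityI subsetI)
      fix e assume e: "e \<in> parcs G"
      then have "fst e \<in> f ` comb_verts L h" "snd e \<in> f ` comb_verts L h"
        unfolding surj by (auto dest: arc_fst_in_verts arc_snd_in_verts)
      then obtain a b where ab: "a \<in> comb_verts L h" "b \<in> comb_verts L h" "e = (f a, f b)"
        by (metis imageE prod.collapse)
      then have "quipu_adj a b" using e assms(2) by (simp add: comb_iso_def)
      then show "e \<in> map_prod f f ` {(a, b). a \<in> comb_verts L h \<and> b \<in> comb_verts L h \<and> quipu_adj a b}"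
        using ab by (auto intro!: image_eqI[of _ _ "(a, b)"])
    qed (use assms(2) in \<open>auto simp: comb_iso_def\<close>)
  qed
qed

text \<open>A spine vector \<open>U\<close> is spread over each arm as \<open>U x\<close> times the
  arm minimiser. On this test vector \<open>3 / sqrt 2 - A\<close> takes the value of
  \<open>spine_form\<close> divided by \<open>sqrt 2\<close>.\<close>

lemma comb_iso_spine_pos_def:
  assumes G: "pair_graph G" and rho: "graph_spectral_radius G < 3 / 2 * sqrt 2" and iso: "comb_iso G L h f"
  shows "spine_pos_def L h"
  unfolding spine_pos_def_def
proof (intro allI impI)
  fix U :: "nat \<Rightarrow> real"
  assume "\<exists>x\<le>L. U x \<noteq> 0"
  then obtain x0 where x0: "x0 \<le> L" "U x0 \<noteq> 0" by blast
  let ?C = "comb_verts L h" and ?r = "3 / 2 * sqrt 2"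
  have "\<exists>p. \<forall>m. p m 0 = 1 \<and>
      ?r * (\<Sum>y\<le>m. (p m y)\<^sup>2) - 2 * (\<Sum>y<m. p m y * p m (Suc y)) = (2 + arm_excess m) / sqrt 2"
    by (rule choice, rule allI, rule arm_minimiser)
  then obtain p :: "nat \<Rightarrow> nat \<Rightarrow> real" where p: "\<And>m. p m 0 = 1"
    "\<And>m. ?r * (\<Sum>y\<le>m. (p m y)\<^sup>2) - 2 * (\<Sum>y<m. p m y * p m (Suc y)) = (2 + arm_excess m) / sqrt 2"
    by blast
  define w where "w = (\<lambda>(x, y). U x * p (h x) y)"
  define u where "u v = w (inv_into ?C f v)" for v
  have bij: "bij_betw f ?C (pverts G)" using iso by (simp add: comb_iso_def)
  have uf: "u (f c) = w c" if "c \<in> ?C" for c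
    using bij that by (simp add: u_def bij_betw_def)
  have c0: "(x0, 0) \<in> ?C" using x0 by (simp add: comb_verts_def)
  then have "f (x0, 0) \<in> pverts G" "u (f (x0, 0)) \<noteq> 0"
    using bij uf[OF c0] x0 p by (auto simp: w_def bij_betw_def)
  then have "(\<Sum>(x, y)\<in>parcs G. u x * u y) < ?r * (\<Sum>x\<in>pverts G. (u x)\<^sup>2)"
    by (intro quadratic_form_less_of_spectral_radius_less[OF G rho]) blast
  also have "(\<Sum>(x, y)\<in>parcs G. u x * u y) =
      (\<Sum>(a, b)\<in>{(a, b). a \<in> ?C \<and> b \<in> ?C \<and> quipu_adj a b}. w a * w b)"
    by (subst sum.reindex_bij_betw[OF comb_iso_arc_bij[OF G iso], symmetric]) (auto simp: uf intro!: sum.cong)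
  also have "\<dots> = 2 * (\<Sum>x<L. w (x, 0) * w (Suc x, 0)) + 2 * (\<Sum>x\<le>L. \<Sum>y<h x. w (x, y) * w (x, Suc y))"
    by (rule comb_arc_sum)
  also have "(\<Sum>x<L. w (x, 0) * w (Suc x, 0)) = (\<Sum>x<L. U x * U (Suc x))"
    by (simp add: w_def p)
  also have "(\<Sum>x\<le>L. \<Sum>y<h x. w (x, y) * w (x, Suc y)) = (\<Sum>x\<le>L. (U x)\<^sup>2 * (\<Sum>y<h x. p (h x) y * p (h x) (Suc y)))"
    by (simp add: w_def sum_distrib_left power2_eq_square mult_ac)
  also have "(\<Sum>x\<in>pverts G. (u x)\<^sup>2) = (\<Sum>c\<in>?C. (w c)\<^sup>2)"
    by (subst sum.reindex_bij_betw[OF bij, symmetric]) (auto simp: uf intro!: sum.cong)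
  also have "\<dots> = (\<Sum>x\<le>L. \<Sum>y\<le>h x. (w (x, y))\<^sup>2)"
    unfolding comb_verts_eq_Sigma by (simp add: sum.Sigma case_prod_beta)
  also have "\<dots> = (\<Sum>x\<le>L. (U x)\<^sup>2 * (\<Sum>y\<le>h x. (p (h x) y)\<^sup>2))"
    by (simp add: w_def power_mult_distrib sum_distrib_left)
  finally have "0 < (\<Sum>x\<le>L. (U x)\<^sup>2 * (?r * (\<Sum>y\<le>h x. (p (h x) y)\<^sup>2) - 2 * (\<Sum>y<h x. p (h x) y * p (h x) (Suc y))))
      - 2 * (\<Sum>x<L. U x * U (Suc x))"
    by (simp add: right_diff_distrib sum_subtractf sum_distrib_left mult_ac)
  also have "\<dots> = (\<Sum>x\<le>L. (2 + arm_excess (h x)) * (U x)\<^sup>2) / sqrt 2 - 2 * (\<Sum>x<L. U x * U (Suc x))"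
    unfolding p(2) by (simp add: sum_divide_distrib mult_ac)
  finally have "0 < sqrt 2 * ((\<Sum>x\<le>L. (2 + arm_excess (h x)) * (U x)\<^sup>2) / sqrt 2 - 2 * (\<Sum>x<L. U x * U (Suc x)))"
    by simp
  also have "\<dots> = spine_form L h U"
    by (simp add: spine_form_def right_diff_distrib)
  finally show "0 < spine_form L h U" .
qed

section \<open>Diameter and isomorphism\<close>

lemma comb_verts_cong: "(\<And>x. x \<le> L \<Longrightarrow> h x = h' x) \<Longrightarrow> comb_verts L h = comb_verts L h'"
  by (auto simp: comb_verts_def)

lemma comb_iso_cong: "comb_iso G L h f \<Longrightarrow> (\<And>x. x \<le> L \<Longrightarrow> h x = h' x) \<Longrightarrow> comb_iso G L h' f"
  using comb_verts_cong[of L h h'] by (simp add: comb_iso_def)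

lemma comb_iso_reflect:
  assumes "comb_iso G L h f"
  shows "comb_iso G L (\<lambda>x. h (L - x)) (\<lambda>(x, y). f (L - x, y))"
proof -
  let ?r = "\<lambda>(x, y). (L - x, y::nat)"
  have bij: "bij_betw ?r (comb_verts L (\<lambda>x. h (L - x))) (comb_verts L h)"
    by (rule bij_betw_byWitness[of _ ?r]) (auto simp: comb_verts_def)
  have adj: "quipu_adj (?r a) (?r b) \<longleftrightarrow> quipu_adj a b"
    if "a \<in> comb_verts L (\<lambda>x. h (L - x))" "b \<in> comb_verts L (\<lambda>x. h (L - x))" for a b
    using that by (auto simp: quipu_adj_def comb_verts_def)
  have f: "(\<lambda>(x, y). f (L - x, y)) = f \<circ> ?r" by auto
  show ?thesis
    unfolding comb_iso_def f
  proof (intro conjI ballI)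
    show "bij_betw (f \<circ> ?r) (comb_verts L (\<lambda>x. h (L - x))) (pverts G)"
      using bij assms by (auto simp: comb_iso_def intro: bij_betw_trans)
    fix a b assume ab: "a \<in> comb_verts L (\<lambda>x. h (L - x))" "b \<in> comb_verts L (\<lambda>x. h (L - x))"
    then have "?r a \<in> comb_verts L h" "?r b \<in> comb_verts L h" using bij_betwE[OF bij] by auto
    then show "((f \<circ> ?r) a, (f \<circ> ?r) b) \<in> parcs G \<longleftrightarrow> quipu_adj a b"
      using assms adj[OF ab] unfolding comb_iso_def comp_def by blast
  qed
qed

section \<open>Isomorphism with the extremal quipu\<close>

text \<open>Under \<open>with_proj\<close> tails and heads are the two projections, so on arcs an
  isomorphism has no freedom: it acts as \<open>map_prod g g\<close>.\<close>

lemma digraph_iso_with_proj_iff: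
  assumes "pair_wf_digraph G"
  shows "digraph_iso (with_proj G) (with_proj H) \<longleftrightarrow>
    (\<exists>g. bij_betw g (pverts G) (pverts H) \<and> parcs H = map_prod g g ` parcs G)"
proof
  interpret pair_wf_digraph G by fact
  assume "digraph_iso (with_proj G) (with_proj H)"
  then obtain hom where hom: "pre_digraph.digraph_isomorphism (with_proj G) hom"
    "with_proj H = app_iso hom (with_proj G)" unfolding digraph_iso_def by blast
  let ?g = "iso_verts hom"
  have H: "pverts H = ?g ` pverts G" "parcs H = iso_arcs hom ` parcs G" "fst = iso_tail hom" "snd = iso_head hom"
    using hom(2) by (auto simp: with_proj_def app_iso_def)
  have "iso_arcs hom e = map_prod ?g ?g e" if "e \<in> parcs G" for e
    using hom(1) that unfolding pre_digraph.digraph_isomorphism_def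
    by (intro prod_eqI) (auto simp flip: H(3,4))
  then have "parcs H = map_prod ?g ?g ` parcs G" unfolding H(2) by (intro image_cong) auto
  moreover have "bij_betw ?g (pverts G) (pverts H)"
    using hom(1) H(1) by (simp add: pre_digraph.digraph_isomorphism_def bij_betw_def)
  ultimately show "\<exists>g. bij_betw g (pverts G) (pverts H) \<and> parcs H = map_prod g g ` parcs G" by blast
next
  interpret pair_wf_digraph G by fact
  assume "\<exists>g. bij_betw g (pverts G) (pverts H) \<and> parcs H = map_prod g g ` parcs G"
  then obtain g where g: "bij_betw g (pverts G) (pverts H)" "parcs H = map_prod g g ` parcs G" by blast
  let ?hom = "\<lparr>iso_verts = g, iso_arcs = map_prod g g, iso_head = snd, iso_tail = fst\<rparr>"
  have "inj_on (map_prod g g) (pverts G \<times> pverts G)"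
    using g(1) by (intro map_prod_inj_on) (auto simp: bij_betw_def)
  then have "inj_on (map_prod g g) (parcs G)"
    by (rule inj_on_subset) (auto dest: in_arcsD1 in_arcsD2)
  then have "pre_digraph.digraph_isomorphism (with_proj G) ?hom"
    using g wf_digraph unfolding pre_digraph.digraph_isomorphism_def by (auto simp: bij_betw_def)
  moreover have "with_proj H = app_iso ?hom (with_proj G)"
    using g by (simp add: with_proj_def app_iso_def bij_betw_def)
  ultimately show "digraph_iso (with_proj G) (with_proj H)" unfolding digraph_iso_def by blast
qed

text \<open>The branch vertices sit at \<open>1\<close> and \<open>1 + (m - 2) + 1 = m\<close>, and
  the horizontal path has length \<open>1 + (m - 2) + m + 1 = 2 * m\<close>;
  \<open>2 \<le> m\<close> keeps the subtraction from truncating.\<close>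

lemma quipu_verts_extremal:
  assumes "2 \<le> m"
  shows "quipu_verts [1, m - 2, m] [1, m] = comb_verts (2 * m) (extremal_arms m)"
proof -
  have pos: "quipu_pos [1, m - 2, m] 0 = 1" "quipu_pos [1, m - 2, m] (Suc 0) = m"
    using assms by (auto simp: quipu_pos_def)
  have "quipu_verts [1, m - 2, m] [1, m] = {(x, 0) | x. x \<le> 2 * m} \<union> {(1, y) | y. y \<le> 1} \<union> {(m, y) | y. y \<le> m}"
    using assms pos by (auto simp: quipu_verts_def less_Suc_eq) force+
  also have "\<dots> = comb_verts (2 * m) (extremal_arms m)"
    using assms by (auto simp: comb_verts_def extremal_arms_def split: if_splits)
  finally show ?thesis .
qed

lemma digraph_iso_extremal_iff:
  assumes G: "pair_graph G" and m: "2 \<le> m"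
  shows "digraph_iso (with_proj G) (with_proj (quipu [1, m - 2, m] [1, m])) \<longleftrightarrow>
    (\<exists>f. comb_iso G (2 * m) (extremal_arms m) f)"
proof -
  interpret pair_graph G by (rule G)
  let ?C = "comb_verts (2 * m) (extremal_arms m)"
  have Q: "pverts (quipu [1, m - 2, m] [1, m]) = ?C"
    "parcs (quipu [1, m - 2, m] [1, m]) = {(a, b). a \<in> ?C \<and> b \<in> ?C \<and> quipu_adj a b}"
    using quipu_verts_extremal[OF m] by (simp_all add: quipu_def)
  show ?thesis
    unfolding digraph_iso_with_proj_iff[OF pair_wf_digraph] Q
  proof
    assume "\<exists>g. bij_betw g (pverts G) ?C \<and> {(a, b). a \<in> ?C \<and> b \<in> ?C \<and> quipu_adj a b} = map_prod g g ` parcs G"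
    then obtain g where g: "bij_betw g (pverts G) ?C"
      and arcs: "{(a, b). a \<in> ?C \<and> b \<in> ?C \<and> quipu_adj a b} = map_prod g g ` parcs G" by blast
    let ?f = "inv_into (pverts G) g"
    have f: "bij_betw ?f ?C (pverts G)" using g by (rule bij_betw_inv_into)
    have gf: "g (?f a) = a" "?f a \<in> pverts G" if "a \<in> ?C" for a
      using that g f by (auto simp: bij_betw_inv_into_right bij_betw_def)
    have fg: "?f (g v) = v" if "v \<in> pverts G" for v
      using that g by (simp add: bij_betw_inv_into_left)
    have "(?f a, ?f b) \<in> parcs G \<longleftrightarrow> quipu_adj a b" if ab: "a \<in> ?C" "b \<in> ?C" for a b
    proof
      assume "(?f a, ?f b) \<in> parcs G"
      then have "map_prod g g (?f a, ?f b) \<in> {(a, b). a \<in> ?C \<and> b \<in> ?C \<and> quipu_adj a b}"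
        unfolding arcs by (rule imageI)
      then show "quipu_adj a b" using gf ab by simp
    next
      assume "quipu_adj a b"
      then have "(a, b) \<in> map_prod g g ` parcs G" unfolding arcs[symmetric] using ab by simp
      then obtain u v where uv: "(u, v) \<in> parcs G" "a = g u" "b = g v" by auto
      then show "(?f a, ?f b) \<in> parcs G" using fg in_arcsD1[OF uv(1)] in_arcsD2[OF uv(1)] by simp
    qed
    then show "\<exists>f. comb_iso G (2 * m) (extremal_arms m) f"
      using f unfolding comb_iso_def by blast
  next
    assume "\<exists>f. comb_iso G (2 * m) (extremal_arms m) f"
    then obtain f where f: "comb_iso G (2 * m) (extremal_arms m) f" by blast
    then have bij: "bij_betw f ?C (pverts G)" by (simp add: comb_iso_def)
    let ?A = "{(a, b). a \<in> ?C \<and> b \<in> ?C \<and> quipu_adj a b}" and ?g = "inv_into ?C f"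
    have "map_prod ?g ?g ` parcs G = map_prod ?g ?g ` map_prod f f ` ?A"
      using comb_iso_arc_bij[OF G f] by (simp add: bij_betw_def)
    also have "\<dots> = (\<lambda>x. x) ` ?A"
      unfolding image_image using bij by (intro image_cong) (auto simp: bij_betw_inv_into_left)
    finally show "\<exists>g. bij_betw g (pverts G) ?C \<and> ?A = map_prod g g ` parcs G"
      using bij_betw_inv_into[OF bij] by (intro exI[of _ ?g]) simp
  qed
qed

section \<open>Distances in combs\<close>

lemma graph_dist_le: "pre_digraph.awalk (with_proj G) u p v \<Longrightarrow> graph_dist G u v \<le> length p"
  unfolding graph_dist_def by (rule Least_le) blast

text \<open>A function growing by at most one along each arc bounds walk lengths from below; it is
  applied to the column coordinate of a comb.\<close>

lemma potential_le_walk_length: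
  fixes \<phi> :: "'a \<Rightarrow> nat"
  assumes "\<And>v w. (v, w) \<in> R \<Longrightarrow> \<phi> w \<le> Suc (\<phi> v)"
  shows "pcas u p v \<Longrightarrow> set p \<subseteq> R \<Longrightarrow> \<phi> v \<le> \<phi> u + length p"
proof (induction p arbitrary: u)
  case (Cons e p)
  then have "\<phi> v \<le> \<phi> (snd e) + length p" by auto
  moreover have "\<phi> (snd e) \<le> Suc (\<phi> (fst e))" using Cons.prems assms[of "fst e" "snd e"] by auto
  moreover have "fst e = u" using Cons.prems by simp
  ultimately show ?case by simp
qed simp

lemma finite_graph_dists:
  assumes "pair_graph G"
  shows "finite {graph_dist G u v | u v. u \<in> pverts G \<and> v \<in> pverts G}"
proof -
  interpret pair_graph G by fact
  have "{graph_dist G u v | u v. u \<in> pverts G \<and> v \<in> pverts G} = (\<lambda>(u, v). graph_dist G u v) ` (pverts G \<times> pverts G)"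
    by auto
  then show ?thesis using pair_finite_verts by simp
qed

lemma comb_iso_diameter_ge:
  assumes G: "pair_graph G" and tree: "undirected_tree G" and iso: "comb_iso G L h f"
  shows "L \<le> graph_diameter G"
proof -
  interpret pair_graph G by (rule G)
  let ?C = "comb_verts L h" and ?u = "f (0, 0)" and ?v = "f (L, 0)"
  have bij: "bij_betw f ?C (pverts G)" using iso by (simp add: comb_iso_def)
  have C: "(0, 0) \<in> ?C" "(L, 0) \<in> ?C" by (auto simp: comb_verts_def)
  then have V: "?u \<in> pverts G" "?v \<in> pverts G" using bij by (auto simp: bij_betw_def)
  define \<phi> where "\<phi> v = fst (inv_into ?C f v)" for v
  have \<phi>: "\<phi> (f c) = fst c" if "c \<in> ?C" for c
    using bij that by (simp add: \<phi>_def bij_betw_inv_into_left)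
  have step: "\<phi> w \<le> Suc (\<phi> v)" if "(v, w) \<in> parcs G" for v w
  proof -
    have "(v, w) \<in> map_prod f f ` {(a, b). a \<in> ?C \<and> b \<in> ?C \<and> quipu_adj a b}"
      using comb_iso_arc_bij[OF G iso] that by (simp add: bij_betw_def)
    then obtain a b where "a \<in> ?C" "b \<in> ?C" "quipu_adj a b" "v = f a" "w = f b" by auto
    then show ?thesis by (auto simp: \<phi> quipu_adj_def)
  qed
  \<comment> \<open>Connectedness provides some walk, so the \<open>LEAST\<close> in
    \<open>graph_dist\<close> is attained by an actual walk.\<close>
  have "?u \<rightarrow>\<^sup>*\<^bsub>mk_symmetric G\<^esub> ?v"
    using tree V unfolding undirected_tree_def connected_def strongly_connected_def by auto
  then have "?u \<rightarrow>\<^sup>*\<^bsub>G\<^esub> ?v" by (simp only: reachable_mk_symmetric_eq[OF pair_sym_arcs])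
  then have "\<exists>k p. awalk ?u p ?v \<and> length p = k" using reachable_awalk by blast
  then have "\<exists>p. awalk ?u p ?v \<and> length p = graph_dist G ?u ?v"
    unfolding graph_dist_def by (rule LeastI_ex)
  then obtain p where p: "awalk ?u p ?v" "length p = graph_dist G ?u ?v" by blast
  have "\<phi> ?v \<le> \<phi> ?u + length p"
    using p(1) step by (intro potential_le_walk_length[of "parcs G"]) (auto simp: awalk_def)
  then have "L \<le> graph_dist G ?u ?v" using C p by (simp add: \<phi>)
  also have "\<dots> \<le> graph_diameter G"
    unfolding graph_diameter_def using V finite_graph_dists[OF G] by (intro Max_ge) auto
  finally show ?thesis .
qed

text \<open>With truncated subtraction \<open>y + (x - m) + (m - x)\<close> is the length of the
  route down the arm and along the spine to \<open>(m, 0)\<close>. Both directions are built because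
  walks follow directed arcs.\<close>

lemma comb_iso_walk_to_centre:
  assumes G: "pair_graph G" and iso: "comb_iso G L h f" and m: "m \<le> L"
  shows "(x, y) \<in> comb_verts L h \<Longrightarrow> y + (x - m) + (m - x) = k \<Longrightarrow>
    (\<exists>p. pre_digraph.awalk (with_proj G) (f (x, y)) p (f (m, 0)) \<and> length p = k) \<and>
    (\<exists>p. pre_digraph.awalk (with_proj G) (f (m, 0)) p (f (x, y)) \<and> length p = k)"
proof (induction k arbitrary: x y)
  case 0
  interpret pair_graph G by (rule G)
  have "f (m, 0) \<in> pverts G" using iso 0 by (auto simp: comb_iso_def bij_betw_def)
  then have "awalk (f (m, 0)) [] (f (m, 0))" by (simp add: awalk_Nil_iff)
  moreover have "x = m" "y = 0" using 0 by auto
  ultimately show ?case by auto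
next
  case (Suc k)
  interpret pair_graph G by (rule G)
  obtain x' y' where c: "(x', y') \<in> comb_verts L h" "quipu_adj (x, y) (x', y')" "y' + (x' - m) + (m - x') = k"
  proof -
    consider "0 < y" | "y = 0" "x < m" | "y = 0" "m < x" using Suc.prems by linarith
    then show thesis
    proof cases
      case 1
      then show ?thesis using Suc.prems by (intro that[of x "y - 1"]) (auto simp: comb_verts_def quipu_adj_def)
    next
      case 2
      then show ?thesis using Suc.prems m by (intro that[of "Suc x" 0]) (auto simp: comb_verts_def quipu_adj_def)
    next
      case 3
      then show ?thesis using Suc.prems by (intro that[of "x - 1" 0]) (auto simp: comb_verts_def quipu_adj_def)
    qed
  qed
  obtain p q where p: "awalk (f (x', y')) p (f (m, 0))" "length p = k"
    and q: "awalk (f (m, 0)) q (f (x', y'))" "length q = k" using Suc.IH[OF c(1,3)] by blast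
  have arc: "(f (x, y), f (x', y')) \<in> parcs G" using iso c Suc.prems by (simp add: comb_iso_def)
  have "awalk (f (x, y)) ((f (x, y), f (x', y')) # p) (f (m, 0))"
    using p arc by (simp add: awalk_Cons_iff)
  moreover have "awalk (f (m, 0)) (q @ [(f (x', y'), f (x, y))]) (f (x, y))"
    using q arcs_symmetric[OF arc] in_arcsD1[OF arc] by (auto simp: awalk_append_iff awalk_Cons_iff awalk_Nil_iff)
  ultimately show ?case using p q by (metis length_Cons length_append_singleton)
qed

text \<open>The point \<open>(m, 0)\<close> is a centre: both spine ends and the tips of both arms
  are \<open>m\<close> steps away, so any two vertices are joined through it by a walk of length at
  most \<open>2 * m\<close>.\<close>

lemma comb_iso_extremal_diameter_le:
  assumes G: "pair_graph G" and iso: "comb_iso G (2 * m) (extremal_arms m) f" and m: "2 \<le> m"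
  shows "graph_diameter G \<le> 2 * m"
proof -
  interpret pair_graph G by (rule G)
  let ?C = "comb_verts (2 * m) (extremal_arms m)" and ?c = "f (m, 0)"
  have surj: "pverts G = f ` ?C" using iso by (simp add: comb_iso_def bij_betw_def)
  have walk: "\<exists>p q. awalk v p ?c \<and> length p \<le> m \<and> awalk ?c q v \<and> length q \<le> m" if "v \<in> pverts G" for v
  proof -
    obtain x y where c: "(x, y) \<in> ?C" "v = f (x, y)" using \<open>v \<in> pverts G\<close> unfolding surj by auto
    have "y + (x - m) + (m - x) \<le> m"
      using c(1) m by (auto simp: comb_verts_def extremal_arms_def split: if_splits)
    moreover obtain p q where "awalk v p ?c" "length p = y + (x - m) + (m - x)"
      "awalk ?c q v" "length q = y + (x - m) + (m - x)"
      using comb_iso_walk_to_centre[OF G iso _ c(1) refl, of m] c(2) by auto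
    ultimately show ?thesis by (intro exI[of _ p] exI[of _ q]) simp
  qed
  have "graph_dist G u v \<le> 2 * m" if uv: "u \<in> pverts G" "v \<in> pverts G" for u v
  proof -
    obtain p where p: "awalk u p ?c" "length p \<le> m" using walk[OF uv(1)] by blast
    obtain q where q: "awalk ?c q v" "length q \<le> m" using walk[OF uv(2)] by blast
    have "awalk u (p @ q) v" using p q by (auto intro: awalk_appendI)
    then have "graph_dist G u v \<le> length (p @ q)" by (rule graph_dist_le)
    then show ?thesis using p q by simp
  qed
  moreover have "(0, 0) \<in> ?C" by (simp add: comb_verts_def)
  then have "f (0, 0) \<in> pverts G" unfolding surj by blast
  ultimately show ?thesis
    unfolding graph_diameter_def using finite_graph_dists[OF G] by (subst Max_le_iff) auto
qed

lemma sum_extremal_arms: "2 \<le> m \<Longrightarrow> (\<Sum>x\<le>2 * m. extremal_arms m x) = m + 1"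
proof -
  assume m: "2 \<le> m"
  have "(\<Sum>x\<le>2 * m. extremal_arms m x) = (\<Sum>x\<in>{1, m}. extremal_arms m x)"
    using m by (intro sum.mono_neutral_right) (auto simp: extremal_arms_def)
  also have "\<dots> = m + 1" using m by (simp add: extremal_arms_def)
  finally show ?thesis .
qed

theorem theorem1p1:
  fixes T :: "'a pair_pre_digraph" and n :: nat
  assumes "pair_graph T"
    and "open_quipu T"
    and "card (pverts T) = n"
    and "n \<ge> 6"
    and "graph_spectral_radius T < 3 / 2 * sqrt 2"
  shows "real (graph_diameter T) \<ge> (2 * real n - 4) / 3 \<and>
    (real (graph_diameter T) = (2 * real n - 4) / 3 \<longleftrightarrow>
      (\<exists>m\<ge>2. digraph_iso (with_proj T) (with_proj (quipu [1, m - 2, m] [1, m]))))"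
proof -
  have tree: "undirected_tree T" using assms(2) by (simp add: open_quipu_def)
  have card: "n = L + 1 + (\<Sum>x\<le>L. h x)" if "comb_iso T L h f" for L h f
    using bij_betw_same_card[of f "comb_verts L h" "pverts T"] that assms(3)
    by (simp add: comb_iso_def card_comb_verts)
  obtain L h f where iso: "comb_iso T L h f" and ends: "h 0 = 0" "h L = 0"
    and fst: "\<And>x. x \<le> L \<Longrightarrow> (\<And>j. j < x \<Longrightarrow> h j = 0) \<Longrightarrow> h x \<le> x"
    and lst: "\<And>x. x \<le> L \<Longrightarrow> (\<And>j. x < j \<Longrightarrow> j \<le> L \<Longrightarrow> h j = 0) \<Longrightarrow> h x \<le> L - x"
    using open_quipu_comb[OF assms(1,2)] by blast
  define H where "H = (\<Sum>x\<le>L. h x)"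
  have n: "n = L + 1 + H" using card[OF iso] by (simp add: H_def)
  have "spine_pos_def L h" using comb_iso_spine_pos_def[OF assms(1,5) iso] .
  from arms_bound[OF this ends fst lst]
  have le: "2 * H \<le> L + 2" and eq: "2 * H = L + 2 \<Longrightarrow> \<exists>m\<ge>2. L = 2 * m \<and>
      ((\<forall>x\<le>L. h x = extremal_arms m x) \<or> (\<forall>x\<le>L. h (L - x) = extremal_arms m x))"
    unfolding H_def by blast+
  have diam: "L \<le> graph_diameter T" using comb_iso_diameter_ge[OF assms(1) tree iso] .
  \<comment> \<open>Substituting \<open>n = L + 1 + H\<close> and \<open>2 * H \<le> L + 2\<close>
    gives \<open>2 * n - 4 \<le> 3 * L\<close>.\<close>
  then have bound: "(2 * real n - 4) / 3 \<le> real (graph_diameter T)" using le n by simp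
  have "\<exists>m\<ge>2. digraph_iso (with_proj T) (with_proj (quipu [1, m - 2, m] [1, m]))"
    if "real (graph_diameter T) = (2 * real n - 4) / 3"
  proof -
    \<comment> \<open>As the diameter is at least \<open>L\<close>, equality leaves no slack in
      \<open>2 * H \<le> L + 2\<close>.\<close>
    have "2 * H = L + 2" using that le diam n by simp
    then obtain m where m: "2 \<le> m" "L = 2 * m"
      and arms: "(\<forall>x\<le>L. h x = extremal_arms m x) \<or> (\<forall>x\<le>L. h (L - x) = extremal_arms m x)"
      using eq by blast
    have "\<exists>f. comb_iso T (2 * m) (extremal_arms m) f"
      using arms
    proof
      assume "\<forall>x\<le>L. h x = extremal_arms m x"
      then show ?thesis using comb_iso_cong[OF iso, of "extremal_arms m"] m(2) by blast
    next
      assume "\<forall>x\<le>L. h (L - x) = extremal_arms m x"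
      then show ?thesis using comb_iso_cong[OF comb_iso_reflect[OF iso], of "extremal_arms m"] m(2) by blast
    qed
    then show ?thesis using digraph_iso_extremal_iff[OF assms(1) m(1)] m(1) by blast
  qed
  moreover have "real (graph_diameter T) = (2 * real n - 4) / 3"
    if m: "2 \<le> m" and quipu: "digraph_iso (with_proj T) (with_proj (quipu [1, m - 2, m] [1, m]))" for m
  proof -
    obtain g where g: "comb_iso T (2 * m) (extremal_arms m) g"
      using digraph_iso_extremal_iff[OF assms(1) m] quipu by blast
    \<comment> \<open>For this \<open>n\<close> the general lower bound is exactly
      \<open>2 * m\<close>, which meets the upper bound on the diameter.\<close>
    have "n = 3 * m + 2" using card[OF g] sum_extremal_arms[OF m] by simp
    then show ?thesis using bound comb_iso_extremal_diameter_le[OF assms(1) g m] by simp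
  qed
  ultimately show ?thesis using bound by blast
qed

end
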